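(* Let $\mathbf{X}$ be a quasi-Polish space. Then the map $\chi_A\mapsto A:\mathcal{C}(\mathbf{X},\mathbb{S}_\mathcal{B})\to\mathcal{B}(\mathbf{X})$ is well-defined (every set $A$ whose characteristic function lies in $\mathcal{C}(\mathbf{X},\mathbb{S}_\mathcal{B})$ is a Borel set) and computable.
   Context: A represented space is a pair $(X,\delta_X)$ with $\delta_X:\subseteq\mathbb{N}^\mathbb{N}\to X$ a partial surjection; a map is computable if some computable $F:\subseteq\mathbb{N}^\mathbb{N}\to\mathbb{N}^\mathbb{N}$ maps names of inputs to names of outputs. $\mathcal{C}(\mathbf{X},\mathbf{Y})$ is the represented space of continuous functions, where $0^n1p$ names $f$ iff the $n$-th oracle Turing machine with oracle $p$ computes a realizer of $f$. $\langle p_0,p_1,\ldots\rangle$ is a standard computable tupling on $\mathbb{N}^\mathbb{N}$. Sierpiński space $\mathbb{S}=\{\top,\bot\}$ is represented by letting $0^\mathbb{N}$ name $\bot$ and every other sequence name $\top$; the open sets $\mathcal{O}(\mathbf{X})$ are represented via their characteristic functions in $\mathcal{C}(\mathbf{X},\mathbb{S})$, with representation $\delta_\mathcal{O}$. The Borel sets $\mathcal{B}(\mathbf{X})$ are represented by $\pi$ with $\pi(0p)=\delta_\mathcal{O}(p)$ and $\pi(1\langle p_0,p_1,\ldots\rangle)=X\setminus\bigcup_n\pi(p_n)$. A quasi-Polish space is here a represented space admitting an equivalent total representation $\delta:\mathbb{N}^\mathbb{N}\to X$ that is effectively open (the map $U\mapsto\delta[U]$, $\mathcal{O}(\mathbb{N}^\mathbb{N})\to\mathcal{O}(\mathbf{X})$,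 is computable). Borel codes: $p\in\mathrm{BC}_0$ iff $p(0)=0$; $p\in\mathrm{BC}_\alpha$ iff $p=1\langle p_0,p_1,\ldots\rangle$ and each $p_n\in\mathrm{BC}_\beta$ for some $\beta<\alpha$; $\mathrm{BC}=\bigcup_{\alpha<\omega_1}\mathrm{BC}_\alpha$. $\mathbb{S}_\mathcal{B}=(\{\bot,\top\},\delta_\mathcal{B})$ with $\mathrm{dom}(\delta_\mathcal{B})=\mathrm{BC}$, $\delta_\mathcal{B}(0p)=\top$, $\delta_\mathcal{B}(1\langle p_0,p_1,\ldots\rangle)=\bigvee_i\neg\delta_\mathcal{B}(p_i)$. For $A\subseteq X$, $\chi_A:X\to\{\top,\bot\}$ is its characteristic function.
   Formalization: Quasi-Polish spaces are additionally required to be T0 (distinct points are separated by an open set), as is usual; without this the claim fails, e.g. for the two-point space where p names a iff p is eventually zero. *)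

theory Defs
  imports Main "HOL-Library.Nat_Bijection" "HOL-Library.FuncSet"
begin

type_synonym baire = "nat \<Rightarrow> nat"

section \<open>Oracle machines\<close>

text \<open>
  Oracle computation is given by Kleene's partial recursive functions relative to an oracle.
  All functions are unary; several arguments are passed through the Cantor pairing
  \<^const>\<open>prod_encode\<close>. These programs compute the same partial functions as oracle Turing machines,
  and \<open>code_of\<close> is an effective numbering of them.
\<close>

datatype code =
    CZero
  | CSucc
  | CFst
  | CSnd
  | COracle
  | CPair code code
  | CComp code code
  | CPrec code code
  | CMu code

text \<open>\<open>eval c r x y\<close>: program \<open>c\<close> with oracle \<open>r\<close> halts on input \<open>x\<close> with output \<open>y\<close>.\<close>

inductive eval :: "code \<Rightarrow> baire \<Rightarrow> nat \<Rightarrow> nat \<Rightarrow> bool" where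
  zero: "eval CZero r x 0"
| succ: "eval CSucc r x (Suc x)"
| fst: "eval CFst r x (fst (prod_decode x))"
| snd: "eval CSnd r x (snd (prod_decode x))"
| query: "eval COracle r x (r x)"
| pair: "eval c r x y \<Longrightarrow> eval d r x z \<Longrightarrow> eval (CPair c d) r x (prod_encode (y, z))"
| comp: "eval d r x y \<Longrightarrow> eval c r y z \<Longrightarrow> eval (CComp c d) r x z"
| prec_0: "eval c r x y \<Longrightarrow> eval (CPrec c d) r (prod_encode (x, 0)) y"
| prec_Suc: "eval (CPrec c d) r (prod_encode (x, n)) y \<Longrightarrow>
    eval d r (prod_encode (x, prod_encode (n, y))) z \<Longrightarrow>
    eval (CPrec c d) r (prod_encode (x, Suc n)) z"
| mu: "eval c r (prod_encode (x, y)) 0 \<Longrightarrow>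
    (\<And>z. z < y \<Longrightarrow> \<exists>v. eval c r (prod_encode (x, z)) (Suc v)) \<Longrightarrow>
    eval (CMu c) r x y"

lemma prod_decode_le:
  "fst (prod_decode m) \<le> m" "snd (prod_decode m) \<le> m"
  by (metis le_prod_encode_1 prod.collapse prod_decode_inverse)
     (metis le_prod_encode_2 prod.collapse prod_decode_inverse)

function code_of :: "nat \<Rightarrow> code" where
  "code_of n =
    (if n = 0 then CZero else if n = 1 then CSucc else if n = 2 then CFst
     else if n = 3 then CSnd else if n = 4 then COracle
     else
       let m = (n - 5) div 4; a = fst (prod_decode m); b = snd (prod_decode m)
       in if (n - 5) mod 4 = 0 then CPair (code_of a) (code_of b)
          else if (n - 5) mod 4 = 1 then CComp (code_of a) (code_of b)
          else if (n - 5) mod 4 = 2 then CPrec (code_of a) (code_of b)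
          else CMu (code_of m))"
  by pat_completeness auto
termination
proof (relation "measure id", goal_cases)
  case 1
  show ?case by simp
qed (auto intro: le_less_trans[OF prod_decode_le(1)] le_less_trans[OF prod_decode_le(2)])

declare code_of.simps [simp del]

lemma div_mod_4_aux:
  fixes x :: nat
  shows "Suc (4 * x) div 4 = x" "Suc (4 * x) mod 4 = 1"
    "Suc (Suc (4 * x)) div 4 = x" "Suc (Suc (4 * x)) mod 4 = 2"
    "Suc (Suc (Suc (4 * x))) div 4 = x" "Suc (Suc (Suc (4 * x))) mod 4 = 3"
    "(2 + 4 * x) div 4 = x" "(2 + 4 * x) mod 4 = 2"
    "(3 + 4 * x) div 4 = x" "(3 + 4 * x) mod 4 = 3"
  by presburger+

lemma code_of_surj: "\<exists>n. code_of n = c"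
proof (induction c)
  case CZero show ?case by (rule exI[of _ 0]) (simp add: code_of.simps)
next
  case CSucc show ?case by (rule exI[of _ 1]) (simp add: code_of.simps)
next
  case CFst show ?case by (rule exI[of _ 2]) (simp add: code_of.simps)
next
  case CSnd show ?case by (rule exI[of _ 3]) (simp add: code_of.simps)
next
  case COracle show ?case by (rule exI[of _ 4]) (simp add: code_of.simps)
next
  case (CPair c d) then obtain a b where "code_of a = c" "code_of b = d" by blast
  then show ?case by (intro exI[of _ "5 + 4 * prod_encode (a,b)"])
      (subst code_of.simps, simp add: Let_def div_mod_4_aux)
next
  case (CComp c d) then obtain a b where "code_of a = c" "code_of b = d" by blast
  then show ?case by (intro exI[of _ "6 + 4 * prod_encode (a,b)"])
      (subst code_of.simps, simp add: Let_def div_mod_4_aux)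
next
  case (CPrec c d) then obtain a b where "code_of a = c" "code_of b = d" by blast
  then show ?case by (intro exI[of _ "7 + 4 * prod_encode (a,b)"])
      (subst code_of.simps, simp add: Let_def div_mod_4_aux)
next
  case (CMu c) then obtain a where "code_of a = c" by blast
  then show ?case by (intro exI[of _ "8 + 4 * a"])
      (subst code_of.simps, simp add: Let_def div_mod_4_aux)
qed

lemma eval_deterministic: "eval c r x y \<Longrightarrow> eval c r x z \<Longrightarrow> y = z"
proof (induction arbitrary: z rule: eval.induct)
  case (mu c r x y)
  from mu.prems show ?case
  proof (cases rule: eval.cases)
    case mu2: mu
    have "\<not> z < y" using mu.IH(2)[of z] mu2 by (metis nat.distinct(1))
    moreover have "\<not> y < z" using mu.IH(1) mu2(2) by (metis nat.distinct(1))
    ultimately show ?thesis by simp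
  qed
next
  case (prec_Suc c d r x n y z w)
  from prec_Suc.prems show ?case
    by (cases rule: eval.cases) (use prec_Suc.IH in auto)
next
  case (prec_0 c r x y d)
  from prec_0.prems show ?case
    by (cases rule: eval.cases) (use prec_0.IH in auto)
next
  case (comp d r x y c z)
  from comp.prems show ?case
    by (cases rule: eval.cases) (use comp.IH in auto)
next
  case (pair c r x y d z)
  from pair.prems show ?case
    by (cases rule: eval.cases) (use pair.IH in auto)
qed (auto elim: eval.cases)

text \<open>The partial function on Baire space computed by the \<open>n\<close>-th machine, its argument being the
  oracle; it is defined where the machine halts on every input.\<close>

definition machine :: "nat \<Rightarrow> baire \<rightharpoonup> baire" where
  "machine n r =
    (if \<forall>k. \<exists>y. eval (code_of n) r k y then Some (\<lambda>k. THE y. eval (code_of n) r k y) else None)"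

definition computable :: "(baire \<rightharpoonup> baire) \<Rightarrow> bool" where
  "computable F \<longleftrightarrow> (\<exists>n. F = machine n)"

definition join :: "baire \<Rightarrow> baire \<Rightarrow> baire" where
  "join p q = (\<lambda>k. if even k then p (k div 2) else q (k div 2))"

text \<open>The \<open>n\<close>-th machine with oracle \<open>p\<close>, as a partial function of its input from Baire space.\<close>

definition machine_with_oracle :: "nat \<Rightarrow> baire \<Rightarrow> baire \<rightharpoonup> baire" where
  "machine_with_oracle n p q = machine n (join p q)"


section \<open>Represented spaces\<close>

text \<open>\<open>\<delta> p x\<close> reads: \<open>p\<close> is a name of \<open>x\<close>. A represented space is given by a single-valued such
  relation; its underlying set is the range of the relation.\<close>

type_synonym 'a rep = "baire \<Rightarrow> 'a \<Rightarrow> bool"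

definition points :: "'a rep \<Rightarrow> 'a set" where
  "points \<delta> = {x. \<exists>p. \<delta> p x}"

definition represented_space :: "'a set \<Rightarrow> 'a rep \<Rightarrow> bool" where
  "represented_space X \<delta> \<longleftrightarrow> right_unique \<delta> \<and> points \<delta> = X"

definition realizes :: "'a rep \<Rightarrow> 'b rep \<Rightarrow> (baire \<rightharpoonup> baire) \<Rightarrow> ('a \<Rightarrow> 'b) \<Rightarrow> bool" where
  "realizes \<delta>\<^sub>X \<delta>\<^sub>Y F f \<longleftrightarrow> (\<forall>q x. \<delta>\<^sub>X q x \<longrightarrow> (\<exists>r. F q = Some r \<and> \<delta>\<^sub>Y r (f x)))"

definition computable_map :: "'a rep \<Rightarrow> 'b rep \<Rightarrow> ('a \<Rightarrow> 'b) \<Rightarrow> bool" where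
  "computable_map \<delta>\<^sub>X \<delta>\<^sub>Y f \<longleftrightarrow> (\<exists>F. computable F \<and> realizes \<delta>\<^sub>X \<delta>\<^sub>Y F f)"

definition equivalent_rep :: "'a rep \<Rightarrow> 'a rep \<Rightarrow> bool" where
  "equivalent_rep \<delta> \<delta>' \<longleftrightarrow> computable_map \<delta> \<delta>' id \<and> computable_map \<delta>' \<delta> id"

text \<open>\<open>indexed n p\<close> is the sequence $0^n 1 p$.\<close>

definition indexed :: "nat \<Rightarrow> baire \<Rightarrow> baire" where
  "indexed n p = (\<lambda>k. if k < n then 0 else if k = n then 1 else p (k - Suc n))"

text \<open>Functions between represented spaces are total HOL functions that take the value
  \<^const>\<open>undefined\<close> outside the underlying set of the domain.\<close>

definition fun_rep :: "'a rep \<Rightarrow> 'b rep \<Rightarrow> ('a \<Rightarrow> 'b) rep" where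
  "fun_rep \<delta>\<^sub>X \<delta>\<^sub>Y s f \<longleftrightarrow>
    f \<in> extensional (points \<delta>\<^sub>X) \<and>
    (\<exists>n p. s = indexed n p \<and> realizes \<delta>\<^sub>X \<delta>\<^sub>Y (machine_with_oracle n p) f)"

lemma indexed_inject: "indexed m p = indexed n q \<longleftrightarrow> m = n \<and> p = q"
proof
  assume *: "indexed m p = indexed n q"
  have "m = n"
    using fun_cong[OF *, of m] fun_cong[OF *, of n]
    by (cases m n rule: linorder_cases) (simp_all add: indexed_def)
  moreover have "p k = q k" for k
    using fun_cong[OF *, of "k + Suc m"] \<open>m = n\<close> by (simp add: indexed_def)
  ultimately show "m = n \<and> p = q" by blast
qed simp

lemma right_unique_fun_rep:
  assumes "right_unique \<delta>\<^sub>Y"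
  shows "right_unique (fun_rep \<delta>\<^sub>X \<delta>\<^sub>Y)"
proof (rule right_uniqueI)
  fix s f g
  assume *: "fun_rep \<delta>\<^sub>X \<delta>\<^sub>Y s f" "fun_rep \<delta>\<^sub>X \<delta>\<^sub>Y s g"
  from *(1) obtain n p where f: "f \<in> extensional (points \<delta>\<^sub>X)" "s = indexed n p"
      "realizes \<delta>\<^sub>X \<delta>\<^sub>Y (machine_with_oracle n p) f"
    unfolding fun_rep_def by blast
  from *(2) obtain m q where g: "g \<in> extensional (points \<delta>\<^sub>X)" "s = indexed m q"
      "realizes \<delta>\<^sub>X \<delta>\<^sub>Y (machine_with_oracle m q) g"
    unfolding fun_rep_def by blast
  have eq: "m = n" "q = p"
    using f(2) g(2) indexed_inject by auto
  show "f = g"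
  proof (rule extensionalityI[OF f(1) g(1)])
    fix x
    assume "x \<in> points \<delta>\<^sub>X"
    then obtain r where "\<delta>\<^sub>X r x" unfolding points_def by blast
    then obtain u v where "machine_with_oracle n p r = Some u" "\<delta>\<^sub>Y u (f x)"
        "machine_with_oracle n p r = Some v" "\<delta>\<^sub>Y v (g x)"
      using f(3) g(3) unfolding eq realizes_def by blast
    then show "f x = g x"
      using right_uniqueD[OF assms] by simp
  qed
qed

definition char_fun :: "'a rep \<Rightarrow> 'a set \<Rightarrow> 'a \<Rightarrow> bool" where
  "char_fun \<delta> A = restrict (\<lambda>x. x \<in> A) (points \<delta>)"

definition set_of_char :: "'a rep \<Rightarrow> ('a \<Rightarrow> bool) \<Rightarrow> 'a set" where
  "set_of_char \<delta> f = {x \<in> points \<delta>. f x}"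

lemma set_of_char_char_fun: "A \<subseteq> points \<delta> \<Longrightarrow> set_of_char \<delta> (char_fun \<delta> A) = A"
  by (auto simp: set_of_char_def char_fun_def)

lemma char_fun_set_of_char:
  "f \<in> extensional (points \<delta>) \<Longrightarrow> char_fun \<delta> (set_of_char \<delta> f) = f"
  by (auto simp: set_of_char_def char_fun_def extensional_def fun_eq_iff)


section \<open>Open sets, Borel sets, quasi-Polish spaces\<close>

text \<open>The points of Sierpinski space are the truth values, \<^const>\<open>True\<close> being the top element.\<close>

definition sierpinski_rep :: "bool rep" where
  "sierpinski_rep p b \<longleftrightarrow> b = (p \<noteq> (\<lambda>_. 0))"

definition open_rep :: "'a rep \<Rightarrow> 'a set rep" where
  "open_rep \<delta> p U \<longleftrightarrow> U \<subseteq> points \<delta> \<and> fun_rep \<delta> sierpinski_rep p (char_fun \<delta> U)"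

text \<open>\<open>case_nat a p\<close> is the sequence \<open>p\<close> with \<open>a\<close> prepended.\<close>

definition tuple :: "(nat \<Rightarrow> baire) \<Rightarrow> baire" where
  "tuple ps = (\<lambda>k. ps (fst (prod_decode k)) (snd (prod_decode k)))"

inductive borel_rep :: "'a rep \<Rightarrow> 'a set rep" for \<delta> :: "'a rep" where
  opn: "open_rep \<delta> p U \<Longrightarrow> borel_rep \<delta> (case_nat 0 p) U"
| compl_Union: "(\<And>n. borel_rep \<delta> (ps n) (A n)) \<Longrightarrow>
    borel_rep \<delta> (case_nat 1 (tuple ps)) (points \<delta> - (\<Union>n. A n))"

lemma tuple_inject: "tuple ps = tuple qs \<longleftrightarrow> ps = qs"
proof
  assume *: "tuple ps = tuple qs"
  have "ps i k = qs i k" for i k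
    using fun_cong[OF *, of "prod_encode (i, k)"] by (simp add: tuple_def)
  then show "ps = qs" by blast
qed simp

lemma case_nat_inject: "case_nat a p = case_nat b q \<longleftrightarrow> a = b \<and> p = (q :: baire)"
proof
  assume *: "case_nat a p = case_nat b q"
  have "p k = q k" for k using fun_cong[OF *, of "Suc k"] by simp
  then show "a = b \<and> p = q" using fun_cong[OF *, of 0] by auto
qed simp

lemma right_unique_open_rep: "right_unique (open_rep \<delta>)"
proof (rule right_uniqueI)
  fix p U V
  assume *: "open_rep \<delta> p U" "open_rep \<delta> p V"
  have "right_unique sierpinski_rep"
    by (rule right_uniqueI) (simp add: sierpinski_rep_def)
  from right_uniqueD[OF right_unique_fun_rep[OF this]] have "char_fun \<delta> U = char_fun \<delta> V"
    using * unfolding open_rep_def by blast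
  then have "set_of_char \<delta> (char_fun \<delta> U) = set_of_char \<delta> (char_fun \<delta> V)"
    by (rule arg_cong)
  then show "U = V"
    using * by (simp add: open_rep_def set_of_char_char_fun)
qed

lemma right_unique_borel_rep: "right_unique (borel_rep \<delta>)"
proof (rule right_uniqueI)
  fix p A B
  assume "borel_rep \<delta> p A" "borel_rep \<delta> p B"
  then show "A = B"
  proof (induction arbitrary: B rule: borel_rep.induct)
    case (opn p U)
    from opn.prems show ?case
      by (cases rule: borel_rep.cases)
        (use opn.hyps right_unique_open_rep in \<open>auto simp: case_nat_inject right_unique_def\<close>)
  next
    case (compl_Union ps A)
    from compl_Union.prems show ?case
    proof (cases rule: borel_rep.cases)
      case (compl_Union qs C)
      then have "A n = C n" for n
        using compl_Union.IH by (auto simp: case_nat_inject tuple_inject)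
      with compl_Union show ?thesis by simp
    qed (simp add: case_nat_inject)
  qed
qed

definition effectively_open :: "'a rep \<Rightarrow> (baire \<Rightarrow> 'a) \<Rightarrow> bool" where
  "effectively_open \<delta>\<^sub>X \<delta> \<longleftrightarrow> computable_map (open_rep (=)) (open_rep \<delta>\<^sub>X) (\<lambda>U. \<delta> ` U)"

definition T0_rep :: "'a rep \<Rightarrow> bool" where
  "T0_rep \<delta> \<longleftrightarrow>
    (\<forall>x\<in>points \<delta>. \<forall>y\<in>points \<delta>. x \<noteq> y \<longrightarrow> (\<exists>U\<in>points (open_rep \<delta>). (x \<in> U) \<noteq> (y \<in> U)))"

text \<open>
  Quasi-Polish spaces are $T_0$, but this does not follow from the existence of a total effectively
  open representation: sending the eventually zero sequences to one point and all other sequences to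
  a second one gives such a representation of a two-point space whose only open sets are the empty
  set and the whole space, although one of its singletons has a characteristic function that is
  continuous into \<open>SB_rep\<close> below. Given the other conditions, $T_0$ amounts to admissibility.
\<close>

definition quasi_polish :: "'a set \<Rightarrow> 'a rep \<Rightarrow> bool" where
  "quasi_polish X \<delta>\<^sub>X \<longleftrightarrow>
    represented_space X \<delta>\<^sub>X \<and> T0_rep \<delta>\<^sub>X \<and>
    (\<exists>\<delta>. equivalent_rep \<delta>\<^sub>X (\<lambda>p x. x = \<delta> p) \<and> effectively_open \<delta>\<^sub>X \<delta>)"


section \<open>Borel codes\<close>

text \<open>The well-order \<open>omega1\<close> has order type $\omega_1$, so its field serves as the set of countable
  ordinals.\<close>

abbreviation omega1 :: "nat set rel" where
  "omega1 \<equiv> cardSuc natLeq"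

inductive BC_at :: "nat set \<Rightarrow> baire \<Rightarrow> bool" where
  zero: "\<alpha> \<in> Field omega1 \<Longrightarrow> underS omega1 \<alpha> = {} \<Longrightarrow> p 0 = 0 \<Longrightarrow> BC_at \<alpha> p"
| step: "(\<And>n. \<exists>\<beta>\<in>underS omega1 \<alpha>. BC_at \<beta> (ps n)) \<Longrightarrow> BC_at \<alpha> (case_nat 1 (tuple ps))"

definition BC :: "baire set" where
  "BC = {p. \<exists>\<alpha>\<in>Field omega1. BC_at \<alpha> p}"

inductive BC_value :: "baire \<Rightarrow> bool \<Rightarrow> bool" where
  zero: "BC_value (case_nat 0 p) True"
| step: "(\<And>i. BC_value (ps i) (v i)) \<Longrightarrow> BC_value (case_nat 1 (tuple ps)) (\<exists>i. \<not> v i)"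

definition SB_rep :: "bool rep" where
  "SB_rep p b \<longleftrightarrow> p \<in> BC \<and> BC_value p b"

lemma right_unique_BC_value: "right_unique BC_value"
proof (rule right_uniqueI)
  fix p a b
  assume "BC_value p a" "BC_value p b"
  then show "a = b"
  proof (induction arbitrary: b rule: BC_value.induct)
    case (zero p)
    from zero.prems show ?case
      by (cases rule: BC_value.cases) (auto simp: case_nat_inject)
  next
    case (step ps v)
    from step.prems show ?case
    proof (cases rule: BC_value.cases)
      case (step qs w)
      then have "v i = w i" for i
        using step.IH by (auto simp: case_nat_inject tuple_inject)
      with step show ?thesis by simp
    qed (simp add: case_nat_inject)
  qed
qed

lemma BC_at_value: "BC_at \<alpha> p \<Longrightarrow> \<exists>b. BC_value p b"
proof (induction rule: BC_at.induct)
  case (zero \<alpha> p)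
  then have "p = case_nat 0 (\<lambda>k. p (Suc k))" by (auto simp: fun_eq_iff split: nat.splits)
  then show ?case using BC_value.zero by metis
next
  case (step \<alpha> ps)
  then have "\<forall>n. \<exists>b. BC_value (ps n) b" by blast
  then obtain v where "BC_value (ps n) (v n)" for n by metis
  then show ?case by (blast intro: BC_value.step)
qed

lemma right_unique_SB_rep: "right_unique SB_rep"
  using right_unique_BC_value by (auto simp: right_unique_def SB_rep_def)

lemma dom_SB_rep: "(\<exists>b. SB_rep p b) \<longleftrightarrow> p \<in> BC"
  using BC_at_value by (auto simp: SB_rep_def BC_def)

lemma omega1_card:
  includes cardinal_syntax
  shows "Card_order omega1" "infinite (Field omega1)" "regularCard omega1" "natLeq <o omega1"
proof -
  show "Card_order omega1" by (rule cardSuc_Card_order) (rule natLeq_Card_order)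
  show "infinite (Field omega1)" using cardSuc_finite[OF natLeq_Card_order] by (simp add: Field_natLeq)
  show "regularCard omega1" 
    by (rule infinite_cardSuc_regularCard) (simp_all add: Field_natLeq natLeq_Card_order natLeq_card_order)
  show "natLeq <o omega1" by (rule cardSuc_greater) (rule natLeq_Card_order)
qed

lemma omega1_bound:
  includes cardinal_syntax
  assumes f: "\<And>n::nat. f n \<in> Field omega1"
  shows "\<exists>\<alpha>\<in>Field omega1. \<forall>n. f n \<in> underS omega1 \<alpha>"
proof -
  note co = omega1_card(1) 
  have wo: "Well_order omega1" using co card_order_on_def by blast
  have "card_of (range f) \<le>o card_of (UNIV::nat set)" by (rule card_of_image)
  then have "card_of (range f) \<le>o natLeq" using card_of_nat ordLeq_ordIso_trans by blast
  then have lt: "card_of (range f) <o omega1" using omega1_card(4) ordLeq_ordLess_trans by blast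
  have sub: "range f \<subseteq> Field omega1" using assms by blast
  have "\<not> cofinal (range f) omega1"
    using omega1_card(3) lt sub not_ordLess_ordIso unfolding regularCard_def by blast
  then obtain a where a: "a \<in> Field omega1" "\<And>b. b \<in> range f \<Longrightarrow> a = b \<or> (a, b) \<notin> omega1"
    unfolding cofinal_def by blast
  have tot: "total_on (Field omega1) omega1" "refl_on (Field omega1) omega1" "trans omega1" "antisym omega1"
    using wo unfolding well_order_on_def linear_order_on_def partial_order_on_def preorder_on_def by auto
  have le: "(f n, a) \<in> omega1" for n
  proof (cases "a = f n")
    case True then show ?thesis using tot(2) a(1) by (auto simp: refl_on_def)
  next
    case False then show ?thesis using tot(1) a f[of n] unfolding total_on_def by blast
  qed
  obtain c where c: "c \<in> Field omega1" "a \<noteq> c" "(a, c) \<in> omega1"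
    using infinite_Card_order_limit[OF co omega1_card(2) a(1)] by blast
  have "f n \<in> underS omega1 c" for n
  proof -
    have "(f n, c) \<in> omega1" using le[of n] c(3) tot(3) by (blast dest: transD)
    moreover have "f n \<noteq> c" using le[of n] c tot(4) by (blast dest: antisymD)
    ultimately show ?thesis by (simp add: underS_def)
  qed
  then show ?thesis using c(1) by blast
qed

lemma omega1_zero: "\<exists>\<alpha>\<in>Field omega1. underS omega1 \<alpha> = {}"
proof -
  have co: "Card_order omega1" by (rule cardSuc_Card_order) (rule natLeq_Card_order)
  have wo: "Well_order omega1" using co card_order_on_def by blast
  then have wf: "wf (omega1 - Id)" by (simp add: well_order_on_def)
  have "Field omega1 \<noteq> {}" using omega1_card(2) by auto
  then obtain x where "x \<in> Field omega1" by blast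
  from wfE_min[OF wf this] obtain z where "z \<in> Field omega1" "\<And>y. (y, z) \<in> omega1 - Id \<Longrightarrow> y \<notin> Field omega1" by blast
  then show ?thesis unfolding underS_def by (auto simp: Field_def)
qed

lemma BC_0: "p 0 = 0 \<Longrightarrow> p \<in> BC"
  using omega1_zero by (auto simp: BC_def intro: BC_at.zero)

lemma BC_cons: assumes "\<And>n. ps n \<in> BC" shows "case_nat 1 (tuple ps) \<in> BC"
proof -
  have "\<forall>n. \<exists>a. a \<in> Field omega1 \<and> BC_at a (ps n)" using assms by (auto simp: BC_def)
  then obtain f where f: "\<And>n. f n \<in> Field omega1" "\<And>n. BC_at (f n) (ps n)" by metis
  obtain a where a: "a\<in>Field omega1" "\<forall>n. f n \<in> underS omega1 a" using omega1_bound[of f] f by blast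
  then have "BC_at a (case_nat 1 (tuple ps))" using f(2) by (blast intro: BC_at.step)
  then show ?thesis using a(1) by (auto simp: BC_def)
qed

end

theory Submission
  imports Defs
begin

text \<open>
  Let \<open>dl\<close> be a total effectively open representation. A realizer sends each \<open>p\<close> to a Borel code
  \<open>G p\<close> of the truth value of \<open>dl p \<in> A\<close>, but a node of \<open>G p\<close> may have different values at different
  names \<open>p\<close> of the same point. As in the Vaught transform, quantify instead over the finite prefixes
  \<open>e\<close> of names: for a point \<open>x\<close> in the image of the cylinder of \<open>e\<close>, say that \<open>e\<close> forces a node
  \<open>w\<close> to be false if \<open>e\<close> suffices to compute that \<open>w\<close> is not a leaf and, for every child of \<open>w\<close>,
  no extension of \<open>e\<close> with \<open>x\<close> in the image of its cylinder forces the child to be false.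
  Images of cylinders are open uniformly in \<open>e\<close>, so unfolding this recursion gives a Borel code for
  the set of points for which no prefix forces the root to be false; the code is well-founded since
  an infinite branch would yield a \<open>p\<close> with \<open>G p\<close> ill-founded. Each fibre of \<open>dl\<close> is a Baire space,
  and along a generic name of \<open>x\<close> the nodes that are false are those that are forced to be false by
  some prefix. Hence the set just coded is \<open>A\<close>.
\<close>

section \<open>Functions computable relative to an oracle\<close>

abbreviation pi1 :: "nat \<Rightarrow> nat" where "pi1 z \<equiv> fst (prod_decode z)"
abbreviation pi2 :: "nat \<Rightarrow> nat" where "pi2 z \<equiv> snd (prod_decode z)"
abbreviation pr :: "nat \<Rightarrow> nat \<Rightarrow> nat" where "pr a b \<equiv> prod_encode (a, b)"

text \<open>Totality for every oracle is built in, so that closure under composition, recursion and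
  case distinction carries no halting conditions. Partial computations enter through bounded
  simulations or through searches known to succeed.\<close>

definition comp_fun :: "(baire \<Rightarrow> nat \<Rightarrow> nat) \<Rightarrow> bool" where
  "comp_fun f \<longleftrightarrow> (\<exists>c. \<forall>r x. eval c r x (f r x))"

definition dec_pred :: "(baire \<Rightarrow> nat \<Rightarrow> bool) \<Rightarrow> bool" where
  "dec_pred P \<longleftrightarrow> comp_fun (\<lambda>r x. if P r x then 1 else 0)"

lemma comp_fun_compose:
  assumes "comp_fun g" "comp_fun f"
  shows "comp_fun (\<lambda>r x. g r (f r x))"
  using assms unfolding comp_fun_def by (meson eval.comp)

text \<open>The language has no identity program; since Cantor pairing is a bijection, pairing the
  two projections yields one.\<close>

lemma comp_fun_id: "comp_fun (\<lambda>r x. x)"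
proof -
  have "eval (CPair CFst CSnd) r x (pr (pi1 x) (pi2 x))" for r x
    by (intro eval.intros)
  then show ?thesis unfolding comp_fun_def by auto
qed

lemma comp_fun_Suc: "comp_fun f \<Longrightarrow> comp_fun (\<lambda>r x. Suc (f r x))"
  unfolding comp_fun_def by (meson eval.comp eval.succ)

lemma comp_fun_const: "comp_fun (\<lambda>r x. k)"
proof (induction k)
  case 0 show ?case unfolding comp_fun_def by (meson eval.zero)
qed (rule comp_fun_Suc)

lemma comp_fun_pi1: "comp_fun f \<Longrightarrow> comp_fun (\<lambda>r x. pi1 (f r x))"
  unfolding comp_fun_def by (meson eval.comp eval.fst)

lemma comp_fun_pi2: "comp_fun f \<Longrightarrow> comp_fun (\<lambda>r x. pi2 (f r x))"
  unfolding comp_fun_def by (meson eval.comp eval.snd)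

lemma comp_fun_pair: "comp_fun f \<Longrightarrow> comp_fun g \<Longrightarrow> comp_fun (\<lambda>r x. pr (f r x) (g r x))"
  unfolding comp_fun_def by (meson eval.pair)

lemma comp_fun_oracle: "comp_fun f \<Longrightarrow> comp_fun (\<lambda>r x. r (f r x))"
  unfolding comp_fun_def by (meson eval.comp eval.query)

lemma comp_fun_rec:
  assumes "comp_fun b" "comp_fun (\<lambda>r z. s r (pi1 z) (pi1 (pi2 z)) (pi2 (pi2 z)))" "comp_fun n"
  shows "comp_fun (\<lambda>r x. rec_nat (b r x) (\<lambda>m y. s r x m y) (n r x))"
proof -
  obtain c d where c: "\<And>r x. eval c r x (b r x)"
    and d: "\<And>r z. eval d r z (s r (pi1 z) (pi1 (pi2 z)) (pi2 (pi2 z)))"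
    using assms unfolding comp_fun_def by blast
  have "eval (CPrec c d) r (pr x m) (rec_nat (b r x) (\<lambda>m y. s r x m y) m)" for r x m
  proof (induction m)
    case 0 show ?case using c by (simp add: eval.prec_0)
  next
    case (Suc m)
    show ?case
      using eval.prec_Suc[OF Suc d] by simp
  qed
  then have "eval (CPrec c d) r z (rec_nat (b r (pi1 z)) (\<lambda>m y. s r (pi1 z) m y) (pi2 z))" for r z
    by (metis prod.collapse prod_decode_inverse)
  then have "comp_fun (\<lambda>r z. rec_nat (b r (pi1 z)) (\<lambda>m y. s r (pi1 z) m y) (pi2 z))"
    unfolding comp_fun_def by blast
  from comp_fun_compose[OF this comp_fun_pair[OF comp_fun_id assms(3)]] show ?thesis by simp
qed

lemma comp_fun_Least:
  assumes "comp_fun (\<lambda>r z. g r (pi1 z) (pi2 z))" and ex: "\<And>r x. \<exists>y. g r x y = 0"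
  shows "comp_fun (\<lambda>r x. LEAST y. g r x y = 0)"
proof -
  obtain c where c: "\<And>r z. eval c r z (g r (pi1 z) (pi2 z))"
    using assms unfolding comp_fun_def by blast
  have "eval (CMu c) r x (LEAST y. g r x y = 0)" for r x
  proof (rule eval.mu)
    show "eval c r (pr x (LEAST y. g r x y = 0)) 0"
      using c[of r "pr x (LEAST y. g r x y = 0)"] LeastI_ex[OF ex] by simp
    show "\<exists>v. eval c r (pr x z) (Suc v)" if "z < (LEAST y. g r x y = 0)" for z
    proof -
      have "g r x z \<noteq> 0" using not_less_Least[OF that] .
      then show ?thesis using c[of r "pr x z"] by (metis fst_conv not0_implies_Suc prod_encode_inverse snd_conv)
    qed
  qed
  then show ?thesis unfolding comp_fun_def by blast
qed

lemmas comp_fun_basic = comp_fun_id comp_fun_const comp_fun_Suc comp_fun_pi1 comp_fun_pi2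
  comp_fun_pair comp_fun_oracle comp_fun_rec

section \<open>Arithmetic, case distinction and bounded quantifiers\<close>

lemma comp_fun_plus:
  assumes "comp_fun f" "comp_fun g" shows "comp_fun (\<lambda>r x. f r x + g r x)"
proof -
  have "rec_nat a (\<lambda>_ y. Suc y) b = a + b" for a b by (induction b) auto
  moreover have "comp_fun (\<lambda>r x. rec_nat (f r x) (\<lambda>_ y. Suc y) (g r x))"
    by (intro comp_fun_basic assms)
  ultimately show ?thesis by simp
qed

lemma comp_fun_minus:
  assumes "comp_fun f" "comp_fun g" shows "comp_fun (\<lambda>r x. f r x - g r x)"
proof -
  \<comment> \<open>The inner recursion is the truncated predecessor; iterating it gives
    subtraction.\<close>
  have 1: "rec_nat 0 (\<lambda>m _. m) a = a - 1" for a by (cases a) auto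
  have "rec_nat a (\<lambda>_ y. rec_nat 0 (\<lambda>m _. m) y) b = a - b" for a b by (induction b) (auto simp: 1)
  moreover have "comp_fun (\<lambda>r x. rec_nat (f r x) (\<lambda>_ y. rec_nat 0 (\<lambda>m _. m) y) (g r x))"
    by (intro comp_fun_basic assms)
  ultimately show ?thesis by simp
qed

text \<open>A recursion of length \<open>0\<close> or \<open>1\<close> whose step ignores its
  arguments selects the branch.\<close>

lemma comp_fun_if:
  assumes "dec_pred P" "comp_fun f" "comp_fun g"
  shows "comp_fun (\<lambda>r x. if P r x then f r x else g r x)"
proof -
  have "comp_fun (\<lambda>r x. rec_nat (g r x) (\<lambda>_ _. f r x) (if P r x then 1 else 0))"
    by (intro comp_fun_rec comp_fun_compose[OF assms(2)] comp_fun_basic assms assms(1)[unfolded dec_pred_def])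
  moreover have "rec_nat (g r x) (\<lambda>_ _. f r x) (if P r x then 1 else 0) = (if P r x then f r x else g r x)" for r x
    by simp
  ultimately show ?thesis by simp
qed

lemma dec_pred_eq:
  assumes "comp_fun f" "comp_fun g" shows "dec_pred (\<lambda>r x. f r x = g r x)"
proof -
  have "comp_fun (\<lambda>r x. 1 - ((f r x - g r x) + (g r x - f r x)))"
    by (intro comp_fun_minus comp_fun_plus comp_fun_basic assms)
  moreover have "1 - ((a - b) + (b - a)) = (if a = b then 1 else 0)" for a b :: nat by simp
  ultimately show ?thesis unfolding dec_pred_def by simp
qed

lemma dec_pred_not: "dec_pred P \<Longrightarrow> dec_pred (\<lambda>r x. \<not> P r x)"
proof -
  assume "dec_pred P"
  then have "comp_fun (\<lambda>r x. if P r x then 0 else 1)" by (intro comp_fun_if comp_fun_basic)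
  moreover have "(if \<not> p then 1 else 0) = (if p then 0 else (1::nat))" for p by simp
  ultimately show ?thesis unfolding dec_pred_def by (simp only:)
qed

lemma dec_pred_less:
  assumes "comp_fun f" "comp_fun g" shows "dec_pred (\<lambda>r x. f r x < g r x)"
proof -
  have "dec_pred (\<lambda>r x. \<not> (g r x - f r x = 0))"
    by (intro dec_pred_not dec_pred_eq comp_fun_minus comp_fun_basic assms)
  then show ?thesis by (simp only: diff_is_0_eq not_le)
qed

lemma dec_pred_le:
  assumes "comp_fun f" "comp_fun g" shows "dec_pred (\<lambda>r x. f r x \<le> g r x)"
  using dec_pred_not[OF dec_pred_less[OF assms(2,1)]] by (simp add: not_less)

lemma dec_pred_and:
  assumes "dec_pred P" "dec_pred Q" shows "dec_pred (\<lambda>r x. P r x \<and> Q r x)"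
proof -
  have "comp_fun (\<lambda>r x. if P r x then (if Q r x then 1 else 0) else 0)"
    by (intro comp_fun_if comp_fun_basic assms)
  moreover have "(if p then (if q then 1 else 0) else 0) = (if p \<and> q then 1 else (0::nat))" for p q by simp
  ultimately show ?thesis unfolding dec_pred_def by simp
qed

lemma dec_pred_or:
  assumes "dec_pred P" "dec_pred Q" shows "dec_pred (\<lambda>r x. P r x \<or> Q r x)"
  using dec_pred_not[OF dec_pred_and[OF dec_pred_not[OF assms(1)] dec_pred_not[OF assms(2)]]] by simp

lemma dec_pred_ex_less:
  assumes "comp_fun n" "dec_pred (\<lambda>r z. P r (pi1 z) (pi2 z))"
  shows "dec_pred (\<lambda>r x. \<exists>j < n r x. P r x j)"
proof -
  have "comp_fun (\<lambda>r z. if P r (pi1 z) (pi1 (pi2 z)) then 1 else pi2 (pi2 z))"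
    using comp_fun_compose[OF assms(2)[unfolded dec_pred_def]
        comp_fun_pair[OF comp_fun_pi1[OF comp_fun_id] comp_fun_pi1[OF comp_fun_pi2[OF comp_fun_id]]]]
    by (intro comp_fun_if comp_fun_basic) (simp add: dec_pred_def)
  then have "comp_fun (\<lambda>r x. rec_nat 0 (\<lambda>m y. if P r x m then 1 else y) (n r x))"
    by (intro comp_fun_rec comp_fun_basic assms)
  moreover have "rec_nat 0 (\<lambda>m y. if P r x m then 1 else y) k = (if \<exists>j<k. P r x j then 1 else (0::nat))" for r x k
    by (induction k) (auto simp: less_Suc_eq)
  ultimately show ?thesis unfolding dec_pred_def by (simp only:)
qed

lemma dec_pred_all_less:
  assumes "comp_fun n" "dec_pred (\<lambda>r z. P r (pi1 z) (pi2 z))"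
  shows "dec_pred (\<lambda>r x. \<forall>j < n r x. P r x j)"
  using dec_pred_not[OF dec_pred_ex_less[OF assms(1) dec_pred_not[OF assms(2)]]] by simp

lemma comp_fun_funpow:
  assumes "comp_fun (\<lambda>r z. f r (pi1 z) (pi2 z))" "comp_fun n" "comp_fun a"
  shows "comp_fun (\<lambda>r x. ((\<lambda>y. f r x y) ^^ n r x) (a r x))"
proof -
  have "comp_fun (\<lambda>r x. rec_nat (a r x) (\<lambda>_ y. f r x y) (n r x))"
    using comp_fun_compose[OF assms(1)
        comp_fun_pair[OF comp_fun_pi1[OF comp_fun_id] comp_fun_pi2[OF comp_fun_pi2[OF comp_fun_id]]]]
    by (intro comp_fun_rec assms) simp
  moreover have "rec_nat y (\<lambda>_. g) k = (g ^^ k) y" for g :: "nat \<Rightarrow> nat" and y k by (induction k) auto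
  ultimately show ?thesis by simp
qed

lemma dec_pred_even:
  assumes "comp_fun f" shows "dec_pred (\<lambda>r x. even (f r x))"
proof -
  have "rec_nat 1 (\<lambda>_ y. 1 - y) k = (if even k then 1 else (0::nat))" for k by (induction k) auto
  moreover have "comp_fun (\<lambda>r x. rec_nat 1 (\<lambda>_ y. 1 - y) (f r x))"
    by (intro comp_fun_minus comp_fun_basic assms)
  ultimately show ?thesis unfolding dec_pred_def by simp
qed

lemma comp_fun_half:
  assumes "comp_fun f" shows "comp_fun (\<lambda>r x. f r x div 2)"
proof -
  have "rec_nat 0 (\<lambda>m y. if even m then y else Suc y) k = k div 2" for k by (induction k) auto
  moreover have "comp_fun (\<lambda>r x. rec_nat 0 (\<lambda>m y. if even m then y else Suc y) (f r x))"
    by (intro comp_fun_if dec_pred_even comp_fun_basic assms)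
  ultimately show ?thesis by simp
qed

lemmas comp_fun_intros = comp_fun_basic comp_fun_plus comp_fun_minus comp_fun_if comp_fun_funpow
  comp_fun_half dec_pred_eq dec_pred_not dec_pred_less dec_pred_le dec_pred_and dec_pred_or
  dec_pred_ex_less dec_pred_all_less dec_pred_even

section \<open>A universal machine\<close>

abbreviation judg :: "nat \<Rightarrow> nat \<Rightarrow> nat \<Rightarrow> nat" where "judg n x y \<equiv> pr n (pr x y)"
abbreviation jn :: "nat \<Rightarrow> nat" where "jn q \<equiv> pi1 q"
abbreviation jx :: "nat \<Rightarrow> nat" where "jx q \<equiv> pi1 (pi2 q)"
abbreviation jy :: "nat \<Rightarrow> nat" where "jy q \<equiv> pi2 (pi2 q)"

lemma pr_pi: "pr (pi1 z) (pi2 z) = z"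
  by simp

text \<open>Partial oracles \<open>u\<close> are total functions in which \<open>0\<close> means undefined and \<open>Suc y\<close> means \<open>y\<close>.
  A judgement \<open>judg n x y\<close> says that program \<open>n\<close> outputs \<open>y\<close> on input \<open>x\<close>; it is justified when it
  follows from the judgements in \<open>K\<close> by one rule of \<^const>\<open>eval\<close>.\<close>

inductive justified :: "(nat \<Rightarrow> nat) \<Rightarrow> nat set \<Rightarrow> nat \<Rightarrow> nat \<Rightarrow> nat \<Rightarrow> bool" for u K where
  zero: "justified u K 0 x 0"
| succ: "justified u K (Suc 0) x (Suc x)"
| fst: "justified u K 2 x (pi1 x)"
| snd: "justified u K 3 x (pi2 x)"
| query: "u x = Suc y \<Longrightarrow> justified u K 4 x y"
| pair: "judg (pi1 m) x y \<in> K \<Longrightarrow> judg (pi2 m) x z \<in> K \<Longrightarrow>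
    justified u K (4 * m + 5) x (pr y z)"
| comp: "judg (pi2 m) x z \<in> K \<Longrightarrow> judg (pi1 m) z y \<in> K \<Longrightarrow>
    justified u K (4 * m + 6) x y"
| prec_0: "judg (pi1 m) x y \<in> K \<Longrightarrow> justified u K (4 * m + 7) (pr x 0) y"
| prec_Suc: "judg (4 * m + 7) (pr x i) z \<in> K \<Longrightarrow>
    judg (pi2 m) (pr x (pr i z)) y \<in> K \<Longrightarrow>
    justified u K (4 * m + 7) (pr x (Suc i)) y"
| mu: "judg m (pr x y) 0 \<in> K \<Longrightarrow> (\<And>z. z < y \<Longrightarrow> \<exists>v. judg m (pr x z) (Suc v) \<in> K) \<Longrightarrow>
    justified u K (4 * m + 8) x y"

text \<open>The only rule that consults the oracle does so at the input \<open>x\<close> of the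
  judgement itself, so agreement at \<open>x\<close> suffices; \<open>certifies_use\<close> turns
  this into a finite bound.\<close>

lemma justified_mono:
  assumes "justified u K n x y" "K \<subseteq> L" "u x \<noteq> 0 \<Longrightarrow> v x = u x"
  shows "justified v L n x y"
  using assms
proof (induction rule: justified.induct)
  case (mu m x y)
  then show ?case by (intro justified.mu) blast+
qed (auto intro: justified.intros)

text \<open>The bounded form of \<^const>\<open>justified\<close>, which is decidable when \<open>K\<close> is an initial
  segment of a sequence.\<close>

lemma justified_bounded:
  "justified u K n x y \<longleftrightarrow>
    (n = 0 \<and> y = 0) \<or> (n = Suc 0 \<and> y = Suc x) \<or> (n = 2 \<and> y = pi1 x) \<or> (n = 3 \<and> y = pi2 x) \<or>
    (n = 4 \<and> u x = Suc y) \<or>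
    (\<exists>m<n. n = 4 * m + 5 \<and>
        (\<exists>a\<in>K. a = judg (pi1 m) x (pi1 y)) \<and> (\<exists>a\<in>K. a = judg (pi2 m) x (pi2 y))) \<or>
    (\<exists>m<n. n = 4 * m + 6 \<and>
        (\<exists>a\<in>K. a = judg (pi2 m) x (jy a) \<and> (\<exists>b\<in>K. b = judg (pi1 m) (jy a) y))) \<or>
    (\<exists>m<n. n = 4 * m + 7 \<and> pi2 x = 0 \<and> (\<exists>a\<in>K. a = judg (pi1 m) (pi1 x) y)) \<or>
    (\<exists>m<n. n = 4 * m + 7 \<and> 0 < pi2 x \<and>
        (\<exists>a\<in>K. a = judg n (pr (pi1 x) (pi2 x - 1)) (jy a) \<and>
          (\<exists>b\<in>K. b = judg (pi2 m) (pr (pi1 x) (pr (pi2 x - 1) (jy a))) y))) \<or>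
    (\<exists>m<n. n = 4 * m + 8 \<and> (\<exists>a\<in>K. a = judg m (pr x y) 0) \<and>
        (\<forall>z<y. \<exists>a\<in>K. a = judg m (pr x z) (jy a) \<and> 0 < jy a))"
  (is "_ \<longleftrightarrow> ?z \<or> ?s \<or> ?f \<or> ?d \<or> ?q \<or> ?p \<or> ?c \<or> ?r0 \<or> ?rS \<or> ?m")
proof
  assume "justified u K n x y"
  then show "?z \<or> ?s \<or> ?f \<or> ?d \<or> ?q \<or> ?p \<or> ?c \<or> ?r0 \<or> ?rS \<or> ?m"
  proof cases
    case (pair m y z)
    then have ?p by (intro exI[of _ m]) simp
    then show ?thesis by blast
  next
    case (comp m z)
    then have "\<exists>a\<in>K. a = judg (pi2 m) x (jy a) \<and> (\<exists>b\<in>K. b = judg (pi1 m) (jy a) y)"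
      by (intro bexI[of _ "judg (pi2 m) x z"]) simp_all
    then have ?c using comp(1) by (intro exI[of _ m]) simp
    then show ?thesis by blast
  next
    case (prec_0 m x)
    then have ?r0 by (intro exI[of _ m]) simp
    then show ?thesis by blast
  next
    case (prec_Suc m x' i z)
    then have "0 < pi2 x \<and> (\<exists>a\<in>K. a = judg n (pr (pi1 x) (pi2 x - 1)) (jy a) \<and>
        (\<exists>b\<in>K. b = judg (pi2 m) (pr (pi1 x) (pr (pi2 x - 1) (jy a))) y))"
      by (simp, intro bexI[of _ "judg n (pr x' i) z"]) simp_all
    then have ?rS using prec_Suc(1) by (intro exI[of _ m]) simp
    then show ?thesis by blast
  next
    case (mu m)
    have "\<exists>a\<in>K. a = judg m (pr x z) (jy a) \<and> 0 < jy a" if z: "z < y" for z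
    proof -
      obtain v where "judg m (pr x z) (Suc v) \<in> K" using mu(3)[OF z] by blast
      then show ?thesis by (intro bexI[of _ "judg m (pr x z) (Suc v)"]) simp_all
    qed
    then have ?m using mu(1,2) by (intro exI[of _ m]) simp
    then show ?thesis by blast
  qed simp_all
next
  assume "?z \<or> ?s \<or> ?f \<or> ?d \<or> ?q \<or> ?p \<or> ?c \<or> ?r0 \<or> ?rS \<or> ?m"
  then consider ?z | ?s | ?f | ?d | ?q | ?p | ?c | ?r0 | ?rS | ?m by argo
  then show "justified u K n x y"
  proof cases
    case 6
    then obtain m where "n = 4 * m + 5" "judg (pi1 m) x (pi1 y) \<in> K" "judg (pi2 m) x (pi2 y) \<in> K"
      by blast
    then show ?thesis using justified.pair[of m x "pi1 y" K "pi2 y" u] by simp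
  next
    case 7
    then obtain m a where "n = 4 * m + 6" "a \<in> K" "a = judg (pi2 m) x (jy a)"
      "judg (pi1 m) (jy a) y \<in> K"
      by blast
    then show ?thesis using justified.comp[of m x "jy a" K y u] by auto
  next
    case 8
    then obtain m where "n = 4 * m + 7" "pi2 x = 0" "judg (pi1 m) (pi1 x) y \<in> K"
      by blast
    then show ?thesis using justified.prec_0[of m "pi1 x" y K u] by (metis pr_pi)
  next
    case 9
    then obtain m a where m: "n = 4 * m + 7" "0 < pi2 x" "a \<in> K"
      "a = judg n (pr (pi1 x) (pi2 x - 1)) (jy a)"
      "judg (pi2 m) (pr (pi1 x) (pr (pi2 x - 1) (jy a))) y \<in> K"
      by blast
    have "judg (4 * m + 7) (pr (pi1 x) (pi2 x - 1)) (jy a) \<in> K"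
      using m(1,3,4) by metis
    from justified.prec_Suc[OF this m(5), of u] show ?thesis using m(1,2) by (simp add: pr_pi)
  next
    case 10
    then obtain m where m: "n = 4 * m + 8" "judg m (pr x y) 0 \<in> K"
      "\<And>z. z < y \<Longrightarrow> \<exists>a\<in>K. a = judg m (pr x z) (jy a) \<and> 0 < jy a"
      by blast
    have "\<exists>v. judg m (pr x z) (Suc v) \<in> K" if z: "z < y" for z
      using m(3)[OF z] by (metis gr0_implies_Suc)
    then show ?thesis unfolding m(1) by (intro justified.mu m(2))
  qed (auto intro: justified.intros)
qed

lemma code_of_add:
  "code_of (4 * m + 5) = CPair (code_of (pi1 m)) (code_of (pi2 m))"
  "code_of (4 * m + 6) = CComp (code_of (pi1 m)) (code_of (pi2 m))"
  "code_of (4 * m + 7) = CPrec (code_of (pi1 m)) (code_of (pi2 m))"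
  "code_of (4 * m + 8) = CMu (code_of m)"
proof -
  have a: "4 * m + 5 - 5 = 4 * m" "4 * m + 6 - 5 = Suc (4 * m)" "4 * m + 7 - 5 = Suc (Suc (4 * m))"
    "4 * m + 8 - 5 = Suc (Suc (Suc (4 * m)))" by simp_all
  show "code_of (4 * m + 5) = CPair (code_of (pi1 m)) (code_of (pi2 m))"
    by (subst code_of.simps) (simp only: a, simp add: Let_def div_mod_4_aux)
  show "code_of (4 * m + 6) = CComp (code_of (pi1 m)) (code_of (pi2 m))"
    by (subst code_of.simps) (simp only: a, simp add: Let_def div_mod_4_aux)
  show "code_of (4 * m + 7) = CPrec (code_of (pi1 m)) (code_of (pi2 m))"
    by (subst code_of.simps) (simp only: a, simp add: Let_def div_mod_4_aux)
  show "code_of (4 * m + 8) = CMu (code_of m)"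
    by (subst code_of.simps) (simp only: a, simp add: Let_def div_mod_4_aux)
qed

lemma code_of_small:
  "code_of 0 = CZero" "code_of (Suc 0) = CSucc" "code_of 2 = CFst" "code_of 3 = CSnd" "code_of 4 = COracle"
  by (simp_all add: code_of.simps)

lemma nat_code_cases:
  fixes n :: nat
  obtains "n = 0" | "n = Suc 0" | "n = 2" | "n = 3" | "n = 4"
  | m where "n = 4 * m + 5" "m < n" | m where "n = 4 * m + 6" "m < n"
  | m where "n = 4 * m + 7" "m < n" | m where "n = 4 * m + 8" "m < n"
proof (cases "n < 5")
  case True
  then have "n = 0 \<or> n = Suc 0 \<or> n = 2 \<or> n = 3 \<or> n = 4" by arith
  then show ?thesis using that by blast
next
  case False
  define m where "m = (n - 5) div 4"
  have "n = 4 * m + 5 \<or> n = 4 * m + 6 \<or> n = 4 * m + 7 \<or> n = 4 * m + 8"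
    using False unfolding m_def by presburger
  moreover have "m < n" using False unfolding m_def by linarith
  ultimately show ?thesis using that by blast
qed

lemma justified_sound:
  assumes "justified u K n x y"
    and K: "\<And>a. a \<in> K \<Longrightarrow> eval (code_of (jn a)) r (jx a) (jy a)"
    and u: "\<And>x y. u x = Suc y \<Longrightarrow> r x = y"
  shows "eval (code_of n) r x y"
proof -
  have K': "eval (code_of a) r b c" if "judg a b c \<in> K" for a b c
    using K[OF that] by simp
  from assms(1) show ?thesis
  proof cases
    case query
    then show ?thesis using u eval.query[of r x] by (auto simp: code_of_small)
  next
    case (prec_Suc m x i z)
    then show ?thesis using K'[of "4 * m + 7" "pr x i" z] K'
      by (auto simp: code_of_add intro!: eval.prec_Suc[of _ _ _ _ _ z])
  next
    case (mu m)
    have "\<exists>v. eval (code_of m) r (pr x z) (Suc v)" if "z < y" for z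
      using mu(3)[OF that] K' by blast
    then show ?thesis using mu K' by (auto simp: code_of_add intro: eval.mu)
  qed (auto simp: code_of_small[simplified] code_of_add u intro: eval.intros K'
)
qed

section \<open>Derivations as lists, and their completeness\<close>

inductive derivation :: "(nat \<Rightarrow> nat) \<Rightarrow> nat list \<Rightarrow> bool" for u where
  Nil: "derivation u []"
| Cons: "derivation u l \<Longrightarrow> justified u (set l) n x y \<Longrightarrow> derivation u (judg n x y # l)"

lemma derivation_append: "derivation u k \<Longrightarrow> derivation u l \<Longrightarrow> derivation u (k @ l)"
proof (induction rule: derivation.induct)
  case (Cons k n x y)
  then show ?case
    by (auto intro!: derivation.Cons justified_mono[of u "set k"])
qed simp

text \<open>Needed for the rule of unbounded search, which has a premise for every smaller value:
  finitely many derivations concatenate to one.\<close>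

lemma derivation_collect:
  assumes "\<And>z. z < (m::nat) \<Longrightarrow> \<exists>l. derivation u l \<and> P z (set l)"
    and mono: "\<And>z K L. P z K \<Longrightarrow> K \<subseteq> L \<Longrightarrow> P z L"
  shows "\<exists>l. derivation u l \<and> (\<forall>z<m. P z (set l))"
  using assms(1)
proof (induction m)
  case 0
  show ?case using derivation.Nil by auto
next
  case (Suc m)
  then obtain k l where "derivation u k" "\<forall>z<m. P z (set k)" "derivation u l" "P m (set l)"
    by (meson less_SucI lessI)
  then show ?case
    by (intro exI[of _ "k @ l"]) (auto simp: less_Suc_eq derivation_append intro: mono)
qed

lemma code_of_inv:
  "code_of n = CZero \<Longrightarrow> n = 0"
  "code_of n = CSucc \<Longrightarrow> n = Suc 0"
  "code_of n = CFst \<Longrightarrow> n = 2"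
  "code_of n = CSnd \<Longrightarrow> n = 3"
  "code_of n = COracle \<Longrightarrow> n = 4"
  "code_of n = CPair c d \<Longrightarrow> \<exists>m<n. n = 4 * m + 5 \<and> code_of (pi1 m) = c \<and> code_of (pi2 m) = d"
  "code_of n = CComp c d \<Longrightarrow> \<exists>m<n. n = 4 * m + 6 \<and> code_of (pi1 m) = c \<and> code_of (pi2 m) = d"
  "code_of n = CPrec c d \<Longrightarrow> \<exists>m<n. n = 4 * m + 7 \<and> code_of (pi1 m) = c \<and> code_of (pi2 m) = d"
  "code_of n = CMu c \<Longrightarrow> \<exists>m<n. n = 4 * m + 8 \<and> code_of m = c"
proof -
  consider "n = 0" | "n = Suc 0" | "n = 2" | "n = 3" | "n = 4"
    | m where "n = 4 * m + 5" "m < n" | m where "n = 4 * m + 6" "m < n"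
    | m where "n = 4 * m + 7" "m < n" | m where "n = 4 * m + 8" "m < n"
    by (rule nat_code_cases)
  then have "(case code_of n of CZero \<Rightarrow> n = 0 | CSucc \<Rightarrow> n = Suc 0 | CFst \<Rightarrow> n = 2 | CSnd \<Rightarrow> n = 3
      | COracle \<Rightarrow> n = 4
      | CPair c d \<Rightarrow> \<exists>m<n. n = 4 * m + 5 \<and> code_of (pi1 m) = c \<and> code_of (pi2 m) = d
      | CComp c d \<Rightarrow> \<exists>m<n. n = 4 * m + 6 \<and> code_of (pi1 m) = c \<and> code_of (pi2 m) = d
      | CPrec c d \<Rightarrow> \<exists>m<n. n = 4 * m + 7 \<and> code_of (pi1 m) = c \<and> code_of (pi2 m) = d
      | CMu c \<Rightarrow> \<exists>m<n. n = 4 * m + 8 \<and> code_of m = c)"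
  proof cases
    case (6 m)
    have *: "code_of n = CPair (code_of (pi1 m)) (code_of (pi2 m))" by (subst 6(1)) (rule code_of_add)
    show ?thesis unfolding * code.case using 6 by (intro exI[of _ m] conjI) (rule refl | assumption)+
  next
    case (7 m)
    have *: "code_of n = CComp (code_of (pi1 m)) (code_of (pi2 m))" by (subst 7(1)) (rule code_of_add)
    show ?thesis unfolding * code.case using 7 by (intro exI[of _ m] conjI) (rule refl | assumption)+
  next
    case (8 m)
    have *: "code_of n = CPrec (code_of (pi1 m)) (code_of (pi2 m))" by (subst 8(1)) (rule code_of_add)
    show ?thesis unfolding * code.case using 8 by (intro exI[of _ m] conjI) (rule refl | assumption)+
  next
    case (9 m)
    have *: "code_of n = CMu (code_of m)" by (subst 9(1)) (rule code_of_add)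
    show ?thesis unfolding * code.case using 9 by (intro exI[of _ m] conjI) (rule refl | assumption)+
  qed (simp_all only: code_of_small code.case)
  then show "code_of n = CZero \<Longrightarrow> n = 0"
    "code_of n = CSucc \<Longrightarrow> n = Suc 0"
    "code_of n = CFst \<Longrightarrow> n = 2"
    "code_of n = CSnd \<Longrightarrow> n = 3"
    "code_of n = COracle \<Longrightarrow> n = 4"
    "code_of n = CPair c d \<Longrightarrow> \<exists>m<n. n = 4 * m + 5 \<and> code_of (pi1 m) = c \<and> code_of (pi2 m) = d"
    "code_of n = CComp c d \<Longrightarrow> \<exists>m<n. n = 4 * m + 6 \<and> code_of (pi1 m) = c \<and> code_of (pi2 m) = d"
    "code_of n = CPrec c d \<Longrightarrow> \<exists>m<n. n = 4 * m + 7 \<and> code_of (pi1 m) = c \<and> code_of (pi2 m) = d"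
    "code_of n = CMu c \<Longrightarrow> \<exists>m<n. n = 4 * m + 8 \<and> code_of m = c"
    by (simp_all only: code.case)
qed

text \<open>Induction on the evaluation: the derivations of the premises are concatenated and the
  new judgement is put in front. \<open>code_of_inv\<close> recovers the numbers of the subprograms
  from \<open>n\<close>.\<close>

lemma derivation_complete:
  assumes "eval c r x y" "code_of n = c" "\<And>x. u x = Suc (r x)"
  shows "\<exists>l. derivation u l \<and> judg n x y \<in> set l"
  using assms
proof (induction arbitrary: n rule: eval.induct)
  case (pair c r x y d z)
  then obtain m where m: "m < n" "n = 4 * m + 5" "code_of (pi1 m) = c" "code_of (pi2 m) = d"
    using code_of_inv(6) by blast
  obtain k l where k: "derivation u k" "judg (pi1 m) x y \<in> set k"
    and l: "derivation u l" "judg (pi2 m) x z \<in> set l"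
    using pair.IH(1)[OF m(3) pair.prems(2)] pair.IH(2)[OF m(4) pair.prems(2)] by blast
  have "justified u (set (k @ l)) n x (pr y z)"
    unfolding m(2) using k(2) l(2) by (intro justified.pair) simp_all
  then show ?case
    using derivation.Cons[OF derivation_append[OF k(1) l(1)]] by (meson list.set_intros(1))
next
  case (comp d r x y c z)
  then obtain m where m: "m < n" "n = 4 * m + 6" "code_of (pi1 m) = c" "code_of (pi2 m) = d"
    using code_of_inv(7) by blast
  obtain k l where k: "derivation u k" "judg (pi2 m) x y \<in> set k"
    and l: "derivation u l" "judg (pi1 m) y z \<in> set l"
    using comp.IH(1)[OF m(4) comp.prems(2)] comp.IH(2)[OF m(3) comp.prems(2)] by blast
  have "justified u (set (k @ l)) n x z"
    unfolding m(2) using k(2) l(2) by (intro justified.comp[of m x y]) simp_all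
  then show ?case
    using derivation.Cons[OF derivation_append[OF k(1) l(1)]] by (meson list.set_intros(1))
next
  case (prec_0 c r x y d)
  then obtain m where m: "m < n" "n = 4 * m + 7" "code_of (pi1 m) = c" "code_of (pi2 m) = d"
    using code_of_inv(8) by blast
  obtain k where k: "derivation u k" "judg (pi1 m) x y \<in> set k"
    using prec_0.IH[OF m(3) prec_0.prems(2)] by blast
  have "justified u (set k) n (pr x 0) y"
    unfolding m(2) using k(2) by (rule justified.prec_0)
  then show ?case
    using derivation.Cons[OF k(1)] by (meson list.set_intros(1))
next
  case (prec_Suc c d r x i y z)
  then obtain m where m: "m < n" "n = 4 * m + 7" "code_of (pi1 m) = c" "code_of (pi2 m) = d"
    using code_of_inv(8) by blast
  obtain k l where k: "derivation u k" "judg n (pr x i) y \<in> set k"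
    and l: "derivation u l" "judg (pi2 m) (pr x (pr i y)) z \<in> set l"
    using prec_Suc.IH(1)[OF prec_Suc.prems] prec_Suc.IH(2)[OF m(4) prec_Suc.prems(2)] by blast
  have "justified u (set (k @ l)) n (pr x (Suc i)) z"
  proof -
    have "judg (4 * m + 7) (pr x i) y \<in> set (k @ l)" "judg (pi2 m) (pr x (pr i y)) z \<in> set (k @ l)"
      using k(2) l(2) m(2) by simp_all
    then show ?thesis unfolding m(2) by (rule justified.prec_Suc)
  qed
  then show ?case
    using derivation.Cons[OF derivation_append[OF k(1) l(1)]] by (meson list.set_intros(1))
next
  case (mu c r x y)
  then obtain m where m: "m < n" "n = 4 * m + 8" "code_of m = c"
    using code_of_inv(9) by blast
  obtain k where k: "derivation u k" "judg m (pr x y) 0 \<in> set k"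
    using mu.IH(1)[OF m(3) mu.prems(2)] by blast
  have "\<exists>l. derivation u l \<and> (\<exists>v. judg m (pr x z) (Suc v) \<in> set l)" if z: "z < y" for z
  proof -
    obtain v where "\<And>n. code_of n = c \<Longrightarrow> (\<And>x. u x = Suc (r x)) \<Longrightarrow>
        \<exists>l. derivation u l \<and> judg n (pr x z) (Suc v) \<in> set l"
      using mu.IH(2)[OF z] by blast
    from this[OF m(3) mu.prems(2)] show ?thesis by blast
  qed
  then obtain l where l: "derivation u l" "\<forall>z<y. \<exists>v. judg m (pr x z) (Suc v) \<in> set l"
    using derivation_collect[of y u "\<lambda>z K. \<exists>v. judg m (pr x z) (Suc v) \<in> K"] by blast
  have "justified u (set (k @ l)) n x y"
  proof -
    have "judg m (pr x y) 0 \<in> set (k @ l)" "\<And>z. z < y \<Longrightarrow> \<exists>v. judg m (pr x z) (Suc v) \<in> set (k @ l)"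
      using k(2) l(2) by (simp, fastforce)
    then show ?thesis unfolding m(2) by (rule justified.mu)
  qed
  then show ?case
    using derivation.Cons[OF derivation_append[OF k(1) l(1)]] by (meson list.set_intros(1))
next
  case (zero r x)
  then have n: "n = 0" using code_of_inv(1) by blast
  have "justified u (set []) n x 0" unfolding n by (rule justified.zero)
  from derivation.Cons[OF derivation.Nil this] show ?case by (meson list.set_intros(1))
next
  case (succ r x)
  then have n: "n = Suc 0" using code_of_inv(2) by blast
  have "justified u (set []) n x (Suc x)" unfolding n by (rule justified.succ)
  from derivation.Cons[OF derivation.Nil this] show ?case by (meson list.set_intros(1))
next
  case (fst r x)
  then have n: "n = 2" using code_of_inv(3) by blast
  have "justified u (set []) n x (pi1 x)" unfolding n by (rule justified.fst)
  from derivation.Cons[OF derivation.Nil this] show ?case by (meson list.set_intros(1))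
next
  case (snd r x)
  then have n: "n = 3" using code_of_inv(4) by blast
  have "justified u (set []) n x (pi2 x)" unfolding n by (rule justified.snd)
  from derivation.Cons[OF derivation.Nil this] show ?case by (meson list.set_intros(1))
next
  case (query r x)
  then have n: "n = 4" using code_of_inv(5) by blast
  have "justified u (set []) n x (r x)" unfolding n by (rule justified.query) (rule query.prems(2))
  from derivation.Cons[OF derivation.Nil this] show ?case by (meson list.set_intros(1))
qed

definition entry :: "nat \<Rightarrow> nat \<Rightarrow> nat" where
  "entry c i = pi1 ((pi2 ^^ i) c)"

text \<open>Read as a nested pair, every number codes an infinite sequence, so codes need no test
  for well-formedness, and any finite list of values is an initial segment of some coded
  sequence.\<close>

lemma entry_surj: "\<exists>c. \<forall>i<L. entry c i = a i"
proof (induction L arbitrary: a)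
  case (Suc L)
  obtain c where c: "\<forall>i<L. entry c i = a (Suc i)" using Suc[of "\<lambda>i. a (Suc i)"] by blast
  have "entry (pr (a 0) c) 0 = a 0" "\<And>i. entry (pr (a 0) c) (Suc i) = entry c i"
    by (simp_all only: entry_def funpow_Suc_right funpow_0 o_apply prod_encode_inverse fst_conv snd_conv)
  then have "\<forall>i<Suc L. entry (pr (a 0) c) i = a i" using c by (simp add: All_less_Suc2)
  then show ?case by blast
qed simp

lemma comp_fun_entry: "comp_fun f \<Longrightarrow> comp_fun g \<Longrightarrow> comp_fun (\<lambda>r x. entry (f r x) (g r x))"
  unfolding entry_def by (intro comp_fun_intros)

text \<open>The certificate \<open>c\<close> codes a derivation of length \<open>pi1 c + 1\<close>, whose last judgement is
  the one of interest.\<close>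

definition certifies :: "(nat \<Rightarrow> nat) \<Rightarrow> nat \<Rightarrow> nat \<Rightarrow> nat \<Rightarrow> bool" where
  "certifies u n x c \<longleftrightarrow>
    (\<forall>i<Suc (pi1 c). justified u (entry (pi2 c) ` {..<i}) (jn (entry (pi2 c) i)) (jx (entry (pi2 c) i))
      (jy (entry (pi2 c) i))) \<and>
    jn (entry (pi2 c) (pi1 c)) = n \<and> jx (entry (pi2 c) (pi1 c)) = x"

definition cert_output :: "nat \<Rightarrow> nat" where
  "cert_output c = jy (entry (pi2 c) (pi1 c))"


lemma certifies_sound:
  assumes "certifies u n x c" and u: "\<And>x y. u x = Suc y \<Longrightarrow> r x = y"
  shows "eval (code_of n) r x (cert_output c)"
proof -
  let ?a = "entry (pi2 c)"
  have "eval (code_of (jn (?a i))) r (jx (?a i)) (jy (?a i))" if "i < Suc (pi1 c)" for i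
    using that
  proof (induction i rule: less_induct)
    case (less i)
    have K: "eval (code_of (jn a)) r (jx a) (jy a)" if "a \<in> ?a ` {..<i}" for a
    proof -
      obtain j where "j < i" "a = ?a j" using \<open>a \<in> ?a ` {..<i}\<close> by blast
      then show ?thesis using less.IH[of j] less.prems by simp
    qed
    have j: "justified u (?a ` {..<i}) (jn (?a i)) (jx (?a i)) (jy (?a i))"
      by (rule assms(1)[unfolded certifies_def, THEN conjunct1, rule_format, OF less.prems])
    show ?case by (rule justified_sound[OF j K u])
  qed
  from this[of "pi1 c"] show ?thesis
    using assms(1) unfolding certifies_def cert_output_def by simp
qed

text \<open>The list is reversed because derivations grow at the head, whereas a certificate lists
  premises first.\<close>

lemma derivation_entries:
  "derivation u l \<Longrightarrow> i < length l \<Longrightarrow>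
    justified u ((!) (rev l) ` {..<i}) (jn (rev l ! i)) (jx (rev l ! i)) (jy (rev l ! i))"
proof (induction rule: derivation.induct)
  case (Cons l n x y)
  have eq: "rev (judg n x y # l) ! j = (if j < length l then rev l ! j else judg n x y)"
    if "j < Suc (length l)" for j
    using that by (auto simp: nth_append not_less less_Suc_eq)
  have im: "(!) (rev (judg n x y # l)) ` {..<i} = (!) (rev l) ` {..<i}" if "i \<le> length l"
    using that by (intro image_cong) (auto simp: nth_append)
  have image_nth: "(!) k ` {..<length k} = set k" for k :: "nat list"
    by (auto simp: set_conv_nth)
  have st: "(!) (rev l) ` {..<length l} = set l"
    using image_nth[of "rev l"] by simp
  show ?case
  proof (cases "i < length l")
    case True
    then show ?thesis using Cons.IH eq[of i] im by simp
  next
    case False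
    then have "i = length l" using Cons.prems by simp
    then show ?thesis using Cons.hyps eq[of i] im st by simp
  qed
qed simp

lemma certifies_complete:
  assumes "eval (code_of n) r x y" and u: "\<And>x. u x = Suc (r x)"
  shows "\<exists>c. certifies u n x c"
proof -
  obtain l where l: "derivation u l" "judg n x y \<in> set l"
    using derivation_complete[OF assms(1) refl u] by blast
  \<comment> \<open>The derivation may go on past the wanted judgement; the certificate is cut off
    at its position \<open>k\<close>.\<close>
  obtain k where k: "k < length l" "rev l ! k = judg n x y"
    using l(2) by (metis in_set_conv_nth length_rev set_rev)
  obtain c where c: "\<forall>i<Suc k. entry c i = rev l ! i" using entry_surj[of "Suc k" "\<lambda>i. rev l ! i"] by blast
  have "certifies u n x (pr k c)"
    unfolding certifies_def
  proof (intro conjI allI impI)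
    fix i assume "i < Suc (pi1 (pr k c))"
    then have i: "i < Suc k" by simp
    have "entry c ` {..<i} = (!) (rev l) ` {..<i}" using i c by (intro image_cong) auto
    then show "justified u (entry (pi2 (pr k c)) ` {..<i}) (jn (entry (pi2 (pr k c)) i))
        (jx (entry (pi2 (pr k c)) i)) (jy (entry (pi2 (pr k c)) i))"
      using derivation_entries[OF l(1), of i] i k c by simp
  qed (use c k in simp_all)
  then show ?thesis by blast
qed

lemma certifies_mono:
  assumes "certifies u n x c" "\<And>x. u x \<noteq> 0 \<Longrightarrow> v x = u x"
  shows "certifies v n x c"
proof -
  let ?a = "entry (pi2 c)"
  have "justified v (?a ` {..<i}) (jn (?a i)) (jx (?a i)) (jy (?a i))" if "i < Suc (pi1 c)" for i
    by (rule justified_mono[OF assms(1)[unfolded certifies_def, THEN conjunct1, rule_format, OF that]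
          subset_refl]) (rule assms(2))
  then show ?thesis using assms(1) unfolding certifies_def by simp
qed

text \<open>The finite use principle: the oracle is consulted only at inputs of judgements in the
  derivation, and \<open>L\<close> exceeds all of them.\<close>

lemma certifies_use:
  assumes "certifies u n x c"
  shows "\<exists>L. \<forall>v. (\<forall>x<L. u x \<noteq> 0 \<longrightarrow> v x = u x) \<longrightarrow> certifies v n x c"
proof -
  let ?a = "entry (pi2 c)"
  define L where "L = Suc (\<Sum>i<Suc (pi1 c). jx (?a i))"
  have L: "jx (?a i) < L" if "i < Suc (pi1 c)" for i
    unfolding L_def less_Suc_eq_le using that by (intro member_le_sum) auto
  have "certifies v n x c" if v: "\<forall>x<L. u x \<noteq> 0 \<longrightarrow> v x = u x" for v
  proof -
    have "justified v (?a ` {..<i}) (jn (?a i)) (jx (?a i)) (jy (?a i))" if "i < Suc (pi1 c)" for i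
    proof (rule justified_mono[OF assms[unfolded certifies_def, THEN conjunct1, rule_format, OF that]
          subset_refl])
      show "v (jx (?a i)) = u (jx (?a i))" if "u (jx (?a i)) \<noteq> 0"
        using v L[OF \<open>i < Suc (pi1 c)\<close>] that by blast
    qed
    then show ?thesis using assms unfolding certifies_def by simp
  qed
  then show ?thesis by blast
qed

lemma comp_fun_cert_output: "comp_fun f \<Longrightarrow> comp_fun (\<lambda>r z. cert_output (f r z))"
  unfolding cert_output_def by (intro comp_fun_intros comp_fun_entry)

lemma dec_pred_certifies:
  assumes u: "comp_fun (\<lambda>r z. u r (pi1 z) (pi2 z))"
    and "comp_fun n" "comp_fun x" "comp_fun c"
  shows "dec_pred (\<lambda>r z. certifies (u r z) (n r z) (x r z) (c r z))"
proof -
  have u': "comp_fun (\<lambda>r z. u r (f r z) (g r z))" if "comp_fun f" "comp_fun g" for f g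
    using comp_fun_compose[OF u comp_fun_pair[OF that]] by simp
  have bex: "(\<exists>a\<in>f ` {..<i}. Q a) \<longleftrightarrow> (\<exists>j<i. Q (f j))" for Q and i :: nat and f :: "nat \<Rightarrow> nat"
    by auto
  \<comment> \<open>Computability has been shown for sums but not for products, so multiples of
    \<open>4\<close> are rewritten as sums.\<close>
  have four: "4 * m = m + m + m + m" for m :: nat by simp
  show ?thesis
    unfolding certifies_def justified_bounded bex four
    by (intro comp_fun_intros comp_fun_entry u' assms
        comp_fun_compose[OF assms(2)] comp_fun_compose[OF assms(3)] comp_fun_compose[OF assms(4)])
qed

text \<open>Outputs use the same convention as partial oracles: \<open>0\<close> if there is no
  certificate below \<open>t\<close>, else the successor of the output of the least one. The bound
  makes simulation total even for diverging programs.\<close>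

definition run :: "(nat \<Rightarrow> nat) \<Rightarrow> nat \<Rightarrow> nat \<Rightarrow> nat \<Rightarrow> nat" where
  "run u n x t = rec_nat 0 (\<lambda>c y. if y = 0 \<and> certifies u n x c then Suc (cert_output c) else y) t"

lemma run_eq_0_iff: "run u n x t = 0 \<longleftrightarrow> (\<forall>c<t. \<not> certifies u n x c)"
  by (induction t) (auto simp: run_def less_Suc_eq)

lemma run_eq_Suc: "run u n x t = Suc v \<Longrightarrow> \<exists>c. certifies u n x c \<and> cert_output c = v"
  by (induction t) (auto simp: run_def split: if_splits)

lemma run_sound:
  assumes "run u n x t = Suc v" and u: "\<And>x y. u x = Suc y \<Longrightarrow> r x = y"
  shows "eval (code_of n) r x v"
proof -
  obtain c where c: "certifies u n x c" "cert_output c = v"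
    using run_eq_Suc[OF assms(1)] by auto
  show ?thesis using certifies_sound[OF c(1) u] c(2) by simp
qed

text \<open>Only being defined is preserved here, since a larger oracle may admit a smaller
  certificate with another output. Equality of outputs comes from \<open>run_sound\<close> once both
  oracles approximate one total oracle.\<close>

lemma run_mono:
  assumes "run u n x t \<noteq> 0" "t \<le> t'" and v: "\<And>x. u x \<noteq> 0 \<Longrightarrow> v x = u x"
  shows "run v n x t' \<noteq> 0"
proof -
  obtain c where c: "c < t" "certifies u n x c" using assms(1) by (auto simp: run_eq_0_iff)
  have "certifies v n x c" by (rule certifies_mono[OF c(2) v])
  then show ?thesis using c(1) assms(2) by (auto simp: run_eq_0_iff intro!: exI[of _ c])
qed

text \<open>\<open>P e\<close> says that \<open>e\<close> approximates the input behind
  \<open>r\<close>; oracle and search bound grow together with \<open>len e\<close>. A certificate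
  for \<open>r\<close> has finite use, so it is valid and within the bound from some length on, and
  soundness fixes the output.\<close>

lemma run_limit:
  fixes len :: "nat \<Rightarrow> nat"
  assumes ev: "eval (code_of n) r x y"
    and sound: "\<And>e x y. P e \<Longrightarrow> u e x = Suc y \<Longrightarrow> r x = y"
    and lim: "\<And>x. \<exists>m. \<forall>e. P e \<longrightarrow> m \<le> len e \<longrightarrow> u e x = Suc (r x)"
  shows "\<exists>m. \<forall>e. P e \<longrightarrow> m \<le> len e \<longrightarrow> run (u e) n x (len e) = Suc y"
proof -
  obtain c where c: "certifies (\<lambda>x. Suc (r x)) n x c"
    using certifies_complete[OF ev, of "\<lambda>x. Suc (r x)"] by auto
  obtain L where L: "\<And>v. \<forall>x<L. Suc (r x) \<noteq> 0 \<longrightarrow> v x = Suc (r x) \<Longrightarrow> certifies v n x c"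
    using certifies_use[OF c] by blast
  have "\<exists>m. \<forall>e. P e \<longrightarrow> m \<le> len e \<longrightarrow> (\<forall>x<L. u e x = Suc (r x))"
  proof (induction L)
    case (Suc L)
    obtain m where m: "\<forall>e. P e \<longrightarrow> m \<le> len e \<longrightarrow> (\<forall>x<L. u e x = Suc (r x))"
      using Suc by blast
    obtain k where k: "\<forall>e. P e \<longrightarrow> k \<le> len e \<longrightarrow> u e L = Suc (r L)"
      using lim by blast
    show ?case using m k by (intro exI[of _ "max m k"]) (auto simp: less_Suc_eq)
  qed simp
  then obtain m where m: "\<And>e. P e \<Longrightarrow> m \<le> len e \<Longrightarrow> \<forall>x<L. u e x = Suc (r x)" by blast
  have "run (u e) n x (len e) = Suc y" if e: "P e" "max m (Suc c) \<le> len e" for e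
  proof -
    have "certifies (u e) n x c" using m[OF e(1)] e(2) by (intro L) simp
    then have "run (u e) n x (len e) \<noteq> 0" using e(2) run_eq_0_iff[of "u e" n x "len e"] by auto
    then obtain v where v: "run (u e) n x (len e) = Suc v" using not0_implies_Suc by blast
    have "eval (code_of n) r x v" using v by (rule run_sound) (rule sound[OF e(1)])
    then show ?thesis using v eval_deterministic[OF ev, of v] by simp
  qed
  then show ?thesis by blast
qed

lemma comp_fun_run:
  assumes u: "comp_fun (\<lambda>r z. u r (pi1 z) (pi2 z))"
    and "comp_fun n" "comp_fun x" "comp_fun t"
  shows "comp_fun (\<lambda>r z. run (u r z) (n r z) (x r z) (t r z))"
proof -
  have u': "comp_fun (\<lambda>r z. u r (f r z) (g r z))" if "comp_fun f" "comp_fun g" for f g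
    using comp_fun_compose[OF u comp_fun_pair[OF that]] by simp
  show ?thesis
    unfolding run_def
    by (intro comp_fun_intros comp_fun_cert_output dec_pred_certifies u' assms
        comp_fun_compose[OF assms(2)] comp_fun_compose[OF assms(3)])
qed

section \<open>Approximations from finite prefixes\<close>

text \<open>A number \<open>e\<close> also codes the finite sequence of length \<open>plen e\<close> with entries \<open>pentry e i\<close>.\<close>

abbreviation plen :: "nat \<Rightarrow> nat" where "plen e \<equiv> pi1 e"
abbreviation pentry :: "nat \<Rightarrow> nat \<Rightarrow> nat" where "pentry e i \<equiv> entry (pi2 e) i"

definition is_prefix :: "nat \<Rightarrow> baire \<Rightarrow> bool" where
  "is_prefix e p \<longleftrightarrow> (\<forall>i<plen e. pentry e i = p i)"

definition extends :: "nat \<Rightarrow> nat \<Rightarrow> bool" where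
  "extends e' e \<longleftrightarrow> plen e \<le> plen e' \<and> (\<forall>i<plen e. pentry e' i = pentry e i)"

lemma prefix_exists: "\<exists>e. plen e = m \<and> is_prefix e p"
proof -
  obtain c where "\<forall>i<m. entry c i = p i" using entry_surj[of m p] by blast
  then show ?thesis by (intro exI[of _ "pr m c"]) (simp add: is_prefix_def)
qed

lemma is_prefix_extends: "is_prefix e' p \<Longrightarrow> extends e' e \<Longrightarrow> is_prefix e p"
  by (auto simp: is_prefix_def extends_def)

lemma extends_refl: "extends e e"
  by (simp add: extends_def)

lemma extends_trans: "extends e2 e1 \<Longrightarrow> extends e1 e0 \<Longrightarrow> extends e2 e0"
  by (auto simp: extends_def)

lemma prefix_linear: "is_prefix e p \<Longrightarrow> is_prefix e' p \<Longrightarrow> plen e \<le> plen e' \<Longrightarrow> extends e' e"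
  by (auto simp: is_prefix_def extends_def)

lemma prefix_amalgam: "is_prefix e p \<Longrightarrow> is_prefix e' p \<Longrightarrow> extends e' e \<or> extends e e'"
  using prefix_linear nat_le_linear by blast

lemma prefix_of_some: "\<exists>p. is_prefix e p"
  by (intro exI[of _ "pentry e"]) (simp add: is_prefix_def)

lemma extends_limit:
  assumes "\<And>k. extends (e (Suc k)) (e k)"
  shows "\<exists>p. \<forall>k. is_prefix (e k) p"
proof -
  have mono: "extends (e (k + d)) (e k)" for k d
    by (induction d) (use assms extends_trans extends_refl in auto)
  \<comment> \<open>Each entry is read off the first prefix long enough to have it. If no prefix is,
    \<open>LEAST\<close> is unspecified, but then the entry is unconstrained.\<close>
  define p where "p i = pentry (e (LEAST k. i < plen (e k))) i" for i
  have "pentry (e k) i = p i" if "i < plen (e k)" for k i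
  proof -
    define l where "l = (LEAST k. i < plen (e k))"
    have l: "i < plen (e l)" "l \<le> k"
      unfolding l_def using LeastI[of "\<lambda>k. i < plen (e k)"] that by (auto intro: Least_le)
    have "extends (e k) (e l)" using mono[of l "k - l"] l(2) by simp
    then show ?thesis using l(1) unfolding p_def l_def[symmetric] by (simp add: extends_def)
  qed
  then show ?thesis unfolding is_prefix_def by blast
qed

lemma dec_pred_extends:
  assumes "comp_fun f" "comp_fun g" shows "dec_pred (\<lambda>r z. extends (f r z) (g r z))"
  unfolding extends_def
  by (intro comp_fun_intros comp_fun_entry assms
      comp_fun_compose[OF assms(1)] comp_fun_compose[OF assms(2)])

text \<open>Once the measure is used up, further iterations are idle, so any upper bound on the
  number of steps may serve as iteration count.\<close>

lemma funpow_stable: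
  fixes \<mu> :: "'s \<Rightarrow> nat"
  assumes stop: "\<And>z. \<mu> z = 0 \<Longrightarrow> f z = z" and dec: "\<And>z. \<mu> z \<noteq> 0 \<Longrightarrow> \<mu> (f z) < \<mu> z"
  shows "\<mu> z \<le> m \<Longrightarrow> \<mu> z \<le> n \<Longrightarrow> (f ^^ m) z = (f ^^ n) z"
proof (induction "\<mu> z" arbitrary: z m n rule: less_induct)
  case less
  show ?case
  proof (cases "\<mu> z = 0")
    case True
    have "(f ^^ k) z = z" for k by (induction k) (use stop True in auto)
    then show ?thesis by simp
  next
    case False
    then obtain m' n' where mn: "m = Suc m'" "n = Suc n'"
      using less.prems by (metis le_zero_eq not0_implies_Suc)
    have "(f ^^ m') (f z) = (f ^^ n') (f z)"
      using dec[OF False] less.prems mn by (intro less.hyps) auto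
    then show ?thesis using mn by (simp only: funpow_Suc_right o_apply)
  qed
qed

text \<open>A path from the root of a Borel code is coded with its last step first: \<open>0\<close> is the root and
  \<open>Suc (pr i w)\<close> the \<open>i\<close>-th child of \<open>w\<close>. The entry \<open>j\<close> of the subcode at \<open>w\<close> is found at
  \<open>path_pos w j\<close> in the whole code.\<close>

definition path_step :: "nat \<Rightarrow> nat" where
  "path_step z =
    (if pi1 z = 0 then z else pr (pi2 (pi1 z - 1)) (Suc (pr (pi1 (pi1 z - 1)) (pi2 z))))"

definition path_pos :: "nat \<Rightarrow> nat \<Rightarrow> nat" where
  "path_pos w j = pi2 ((path_step ^^ w) (pr w j))"

lemma path_pos_0: "path_pos 0 j = j"
  by (simp add: path_pos_def)

lemma path_pos_Suc: "path_pos (Suc (pr i w)) j = path_pos w (Suc (pr i j))"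
proof -
  have step: "path_step (pr (Suc (pr i w)) j) = pr w (Suc (pr i j))"
    by (simp add: path_step_def)
  have dec: "pi1 (path_step z) < pi1 z" if "pi1 z \<noteq> 0" for z
  proof -
    have "pi2 (pi1 z - 1) \<le> pi1 z - 1" by (rule prod_decode_le)
    then show ?thesis using that by (simp add: path_step_def)
  qed
  \<comment> \<open>\<open>path_pos\<close> iterates as often as the number coding the path. Both
    \<open>pr i w\<close> and \<open>w\<close> bound the steps that remain, so the two counts give
    the same result.\<close>
  have "(path_step ^^ pr i w) (pr w (Suc (pr i j))) = (path_step ^^ w) (pr w (Suc (pr i j)))"
  proof (rule funpow_stable[of pi1 path_step])
    show "path_step z = z" if "pi1 z = 0" for z using that by (simp add: path_step_def)
    show "pi1 (pr w (Suc (pr i j))) \<le> pr i w" by (simp add: le_prod_encode_2)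
  qed (simp_all add: dec)
  then show ?thesis
    unfolding path_pos_def by (simp only: funpow_Suc_right o_apply step)
qed

lemma comp_fun_path_pos: "comp_fun f \<Longrightarrow> comp_fun g \<Longrightarrow> comp_fun (\<lambda>r z. path_pos (f r z) (g r z))"
  unfolding path_pos_def path_step_def by (intro comp_fun_intros)

section \<open>Approximating the labels of the computed Borel code\<close>

definition finite_oracle :: "nat \<Rightarrow> nat \<Rightarrow> nat" where
  "finite_oracle e x = (if x < plen e then Suc (pentry e x) else 0)"

text \<open>In a name \<open>s = indexed n p\<close>, the search for \<open>n\<close> is bounded by \<open>t\<close>, so as to be total.\<close>

definition name_index :: "baire \<Rightarrow> nat \<Rightarrow> nat" where
  "name_index s t = rec_nat 0 (\<lambda>_ y. if s y = 0 then Suc y else y) t"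

text \<open>For \<open>s = indexed n p\<close> this approximates \<open>join p (E q)\<close>, where
  \<open>e\<close> is a prefix of \<open>q\<close> and machine \<open>nE\<close> computes
  \<open>E\<close>. The length of \<open>e\<close> also serves as time bound.\<close>

definition join_oracle :: "nat \<Rightarrow> baire \<Rightarrow> nat \<Rightarrow> nat \<Rightarrow> nat" where
  "join_oracle nE s e x =
    (if even x then Suc (s (x div 2 + Suc (name_index s (plen e))))
     else run (finite_oracle e) nE (x div 2) (plen e))"

text \<open>\<open>label nE s e w\<close> is \<open>0\<close> if the prefix \<open>e\<close> does not yet determine the label of the node \<open>w\<close> in
  the Borel code computed from \<open>s\<close>, and otherwise the successor of that label.\<close>

definition label :: "nat \<Rightarrow> baire \<Rightarrow> nat \<Rightarrow> nat \<Rightarrow> nat" where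
  "label nE s e w =
    (if s (name_index s (plen e)) = 0 then 0
     else run (join_oracle nE s e) (name_index s (plen e)) (path_pos w 0) (plen e))"

lemma comp_fun_label:
  assumes "comp_fun f" "comp_fun g" shows "comp_fun (\<lambda>s z. label nE s (f s z) (g s z))"
  unfolding label_def join_oracle_def finite_oracle_def name_index_def
  by (intro comp_fun_intros comp_fun_run comp_fun_path_pos comp_fun_entry
      assms
      comp_fun_compose[OF assms(1)] comp_fun_compose[OF assms(2)])

lemma name_index_indexed: "name_index (indexed n p) t = min t n"
  by (induction t) (auto simp: name_index_def indexed_def min_def)

lemma the_eval: "eval c r k v \<Longrightarrow> (THE v. eval c r k v) = v"
  by (rule the_equality, assumption, rule eval_deterministic)

lemma machine_eq_SomeD:
  assumes "machine n r = Some y"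
  shows "eval (code_of n) r k (y k)"
proof -
  have ex: "\<exists>v. eval (code_of n) r k v" and y: "y = (\<lambda>k. THE v. eval (code_of n) r k v)"
    using assms unfolding machine_def by (simp_all split: if_splits)
  obtain v where v: "eval (code_of n) r k v" using ex by (rule exE)
  then show ?thesis using the_eval[OF v] unfolding y by simp
qed

lemma machine_eq_SomeI:
  assumes "\<And>k. eval (code_of n) r k (y k)"
  shows "machine n r = Some y"
proof -
  have "\<forall>k. \<exists>v. eval (code_of n) r k v" using assms by (intro allI exI)
  moreover have "(\<lambda>k. THE v. eval (code_of n) r k v) = y" by (intro ext the_eval assms)
  ultimately show ?thesis unfolding machine_def by simp
qed

lemma comp_fun_machine:
  assumes "comp_fun f" shows "\<exists>n. \<forall>r. machine n r = Some (f r)"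
proof -
  obtain c where c: "\<And>r x. eval c r x (f r x)" using assms unfolding comp_fun_def by blast
  obtain n where "code_of n = c" using code_of_surj by blast
  then have "machine n r = Some (f r)" for r using c by (intro machine_eq_SomeI) simp
  then show ?thesis by blast
qed

text \<open>In the application \<open>E\<close> translates names under the total representation into
  names under the given one, and \<open>G\<close> computes the Borel code of the truth
  value.\<close>

locale approximation_data =
  fixes nE n :: nat and p :: baire and E G :: "baire \<Rightarrow> baire"
  assumes E: "machine nE q = Some (E q)" and G: "machine n (join p (E q)) = Some (G q)"
begin

abbreviation lab :: "nat \<Rightarrow> nat \<Rightarrow> nat" where "lab \<equiv> label nE (indexed n p)"

lemma finite_oracle_sound: "is_prefix e q \<Longrightarrow> finite_oracle e x = Suc y \<Longrightarrow> q x = y"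
  by (auto simp: finite_oracle_def is_prefix_def split: if_splits)

lemma E_sound:
  assumes "is_prefix e q" "run (finite_oracle e) nE j t = Suc y"
  shows "E q j = y"
  by (rule eval_deterministic[OF machine_eq_SomeD[OF E] run_sound[OF assms(2)]])
    (rule finite_oracle_sound[OF assms(1)])

lemma E_limit:
  "\<exists>m. \<forall>e. is_prefix e q \<longrightarrow> m \<le> plen e \<longrightarrow> run (finite_oracle e) nE j (plen e) = Suc (E q j)"
proof (rule run_limit)
  show "eval (code_of nE) q j (E q j)" by (rule machine_eq_SomeD[OF E])
  show "\<exists>m. \<forall>e. is_prefix e q \<longrightarrow> m \<le> plen e \<longrightarrow> finite_oracle e x = Suc (q x)" for x
    by (rule exI[of _ "Suc x"]) (auto simp: finite_oracle_def is_prefix_def)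
qed (rule finite_oracle_sound)

text \<open>A prefix shorter than \<open>n\<close> stops the bounded search within the leading zeros
  of the name and therefore determines no label.\<close>

lemma label_eq:
  "lab e w = (if plen e < n then 0 else run (join_oracle nE (indexed n p) e) n (path_pos w 0) (plen e))"
  by (simp add: label_def name_index_indexed) (simp add: indexed_def min_def)

lemma join_oracle_eq:
  "n \<le> plen e \<Longrightarrow> join_oracle nE (indexed n p) e x =
    (if even x then Suc (p (x div 2)) else run (finite_oracle e) nE (x div 2) (plen e))"
  by (simp add: join_oracle_def name_index_indexed) (simp add: indexed_def)

lemma join_oracle_sound:
  assumes "n \<le> plen e" "is_prefix e q" "join_oracle nE (indexed n p) e x = Suc y"
  shows "join p (E q) x = y"
  using assms E_sound[OF assms(2)] by (auto simp: join_oracle_eq join_def split: if_splits)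

lemma label_sound:
  assumes "lab e w = Suc v" "is_prefix e q"
  shows "G q (path_pos w 0) = v"
proof -
  have n: "n \<le> plen e" and r: "run (join_oracle nE (indexed n p) e) n (path_pos w 0) (plen e) = Suc v"
    using assms(1) by (auto simp: label_eq split: if_splits)
  show ?thesis
    by (rule eval_deterministic[OF machine_eq_SomeD[OF G] run_sound[OF r]])
      (rule join_oracle_sound[OF n assms(2)])
qed

text \<open>Two nested limits: the simulation of \<open>nE\<close> converges at every position,
  hence so does the approximate oracle of machine \<open>n\<close>, and \<open>run_limit\<close>
  applies again.\<close>

lemma label_limit:
  "\<exists>m. \<forall>e. is_prefix e q \<longrightarrow> m \<le> plen e \<longrightarrow> lab e w = Suc (G q (path_pos w 0))"
proof -
  have "\<exists>m. \<forall>e. (is_prefix e q \<and> n \<le> plen e) \<longrightarrow> m \<le> plen e \<longrightarrow>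
      run (join_oracle nE (indexed n p) e) n (path_pos w 0) (plen e) = Suc (G q (path_pos w 0))"
  proof (rule run_limit)
    show "eval (code_of n) (join p (E q)) (path_pos w 0) (G q (path_pos w 0))"
      by (rule machine_eq_SomeD[OF G])
    show "join p (E q) x = y"
      if "is_prefix e q \<and> n \<le> plen e" "join_oracle nE (indexed n p) e x = Suc y" for e x y
      using join_oracle_sound that by blast
    show "\<exists>m. \<forall>e. (is_prefix e q \<and> n \<le> plen e) \<longrightarrow> m \<le> plen e \<longrightarrow>
        join_oracle nE (indexed n p) e x = Suc (join p (E q) x)" for x
      using E_limit[of q "x div 2"] by (auto simp: join_oracle_eq join_def)
  qed
  then obtain m where m: "\<And>e. is_prefix e q \<and> n \<le> plen e \<Longrightarrow> m \<le> plen e \<Longrightarrow>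
      run (join_oracle nE (indexed n p) e) n (path_pos w 0) (plen e) = Suc (G q (path_pos w 0))"
    by blast
  show ?thesis by (rule exI[of _ "max m n"]) (auto simp: label_eq m)
qed

text \<open>\<open>run_mono\<close> keeps a label defined. That it does not change is seen on an
  arbitrary sequence \<open>q\<close> through \<open>e'\<close>, where soundness fixes both
  values.\<close>

lemma label_mono:
  assumes "lab e w \<noteq> 0" "extends e' e"
  shows "lab e' w = lab e w"
proof -
  have n: "n \<le> plen e" and r: "run (join_oracle nE (indexed n p) e) n (path_pos w 0) (plen e) \<noteq> 0"
    using assms(1) by (auto simp: label_eq split: if_splits)
  have le: "plen e \<le> plen e'" using assms(2) by (simp add: extends_def)
  obtain q where q: "is_prefix e' q" using prefix_of_some by blast
  then have q': "is_prefix e q" using is_prefix_extends assms(2) by blast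
  have run: "run (finite_oracle e') nE j (plen e') = run (finite_oracle e) nE j (plen e)"
    if nz: "run (finite_oracle e) nE j (plen e) \<noteq> 0" for j
  proof -
    have "run (finite_oracle e') nE j (plen e') \<noteq> 0"
      by (rule run_mono[OF nz le]) (use assms(2) in \<open>auto simp: finite_oracle_def extends_def split: if_splits\<close>)
    then show ?thesis using nz E_sound[OF q, of j] E_sound[OF q', of j] by (metis not0_implies_Suc)
  qed
  have "run (join_oracle nE (indexed n p) e') n (path_pos w 0) (plen e') \<noteq> 0"
    by (rule run_mono[OF r le]) (use n le run in \<open>auto simp: join_oracle_eq split: if_splits\<close>)
  then have "lab e' w \<noteq> 0" using n le by (simp add: label_eq)
  then show ?thesis using assms(1) label_sound[OF _ q, of w] label_sound[OF _ q', of w]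
    by (metis not0_implies_Suc)
qed

end

section \<open>The Borel code of the transform\<close>

text \<open>The states of the unfolding, by tag: \<open>1\<close> stands for the set of points \<open>x\<close> such that no
  extension of \<open>e\<close> with \<open>x\<close> in the image of its cylinder forces \<open>w\<close> to be false, \<open>0\<close> for the
  complement of this set, \<open>2\<close> for the set of points for which \<open>e\<close> forces \<open>w\<close> to be false, \<open>4\<close> for
  the image of the cylinder of \<open>e\<close>, and \<open>3\<close> for its complement. A state with tag below \<open>4\<close> is the
  complement of the union of its children.\<close>

abbreviation state :: "nat \<Rightarrow> nat \<Rightarrow> nat \<Rightarrow> nat" where "state t e w \<equiv> pr t (pr e w)"

text \<open>As labels are shifted by one, \<open>2 \<le> lab e w\<close> means that \<open>e\<close>
  shows \<open>w\<close> to be an inner node. At tag \<open>1\<close>, indices that are not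
  extensions of \<open>e\<close> are replaced by \<open>e\<close>. At tag \<open>2\<close>, child
  \<open>0\<close> cuts the set down to the image of the cylinder; if \<open>w\<close> is not known
  to be inner, the remaining children remove this image too and the set is empty.\<close>

definition child :: "(nat \<Rightarrow> nat \<Rightarrow> nat) \<Rightarrow> nat \<Rightarrow> nat \<Rightarrow> nat" where
  "child lab st i =
    (if pi1 st = 0 then state (Suc 0) (pi1 (pi2 st)) (pi2 (pi2 st))
     else if pi1 st = 1 then
       state 2 (if extends i (pi1 (pi2 st)) then i else pi1 (pi2 st)) (pi2 (pi2 st))
     else if pi1 st = 2 then
       (if i = 0 then state 3 (pi1 (pi2 st)) (pi2 (pi2 st))
        else if lab (pi1 (pi2 st)) (pi2 (pi2 st)) < 2 then state 4 (pi1 (pi2 st)) (pi2 (pi2 st))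
        else state 0 (pi1 (pi2 st)) (Suc (pr (i - 1) (pi2 (pi2 st)))))
     else state 4 (pi1 (pi2 st)) (pi2 (pi2 st)))"

text \<open>\<open>z\<close> pairs a state with a position in its code. A step enters the child
  containing that position and strictly lowers the position.\<close>

definition descend :: "(nat \<Rightarrow> nat \<Rightarrow> nat) \<Rightarrow> nat \<Rightarrow> nat" where
  "descend lab z =
    (if 3 < pi1 (pi1 z) \<or> pi2 z = 0 then z
     else pr (child lab (pi1 z) (pi1 (pi2 z - 1))) (pi2 (pi2 z - 1)))"

text \<open>The unfolding might a priori be ill-founded, so the code is defined entry by entry and
  not by recursion on states; \<open>k\<close> steps suffice for entry \<open>k\<close>.
  Well-foundedness is settled in \<open>coded_V\<close>.\<close>

definition bcode :: "(nat \<Rightarrow> nat \<Rightarrow> nat) \<Rightarrow> (nat \<Rightarrow> baire) \<Rightarrow> nat \<Rightarrow> baire" where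
  "bcode lab opn st k =
    (if 3 < pi1 (pi1 ((descend lab ^^ k) (pr st k))) then
       (if pi2 ((descend lab ^^ k) (pr st k)) = 0 then 0
        else opn (pi1 (pi2 (pi1 ((descend lab ^^ k) (pr st k))))) (pi2 ((descend lab ^^ k) (pr st k)) - 1))
     else 1)"

lemma bcode_leaf:
  assumes "3 < pi1 st"
  shows "bcode lab opn st = case_nat 0 (opn (pi1 (pi2 st)))"
proof
  fix k
  have "descend lab (pr st k) = pr st k" using assms by (simp add: descend_def)
  then have "(descend lab ^^ m) (pr st k) = pr st k" for m by (induction m) simp_all
  then show "bcode lab opn st k = case_nat 0 (opn (pi1 (pi2 st))) k"
    using assms by (simp add: bcode_def split: nat.split)
qed

lemma bcode_node:
  assumes "\<not> 3 < pi1 st"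
  shows "bcode lab opn st = case_nat 1 (tuple (\<lambda>i. bcode lab opn (child lab st i)))"
proof
  fix k
  let ?\<mu> = "\<lambda>z. if 3 < pi1 (pi1 z) then 0 else pi2 z"
  have stop: "descend lab z = z" if "?\<mu> z = 0" for z
    using that by (auto simp: descend_def split: if_splits)
  have dec: "?\<mu> (descend lab z) < ?\<mu> z" if "?\<mu> z \<noteq> 0" for z
  proof -
    have *: "\<not> 3 < pi1 (pi1 z)" "0 < pi2 z" using that by (auto split: if_splits)
    have "pi2 (pi2 z - 1) \<le> pi2 z - 1" by (rule prod_decode_le)
    then have "?\<mu> (descend lab z) \<le> pi2 z - 1" using * by (simp add: descend_def)
    then show ?thesis using * by simp
  qed
  show "bcode lab opn st k = case_nat 1 (tuple (\<lambda>i. bcode lab opn (child lab st i))) k"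
  proof (cases k)
    case 0
    then show ?thesis using assms by (simp add: bcode_def)
  next
    case (Suc m)
    let ?z = "pr (child lab st (pi1 m)) (pi2 m)"
    have "descend lab (pr st k) = ?z" using assms Suc by (simp add: descend_def)
    then have "(descend lab ^^ k) (pr st k) = (descend lab ^^ m) ?z"
      unfolding Suc by (simp only: funpow_Suc_right o_apply)
    also have "\<dots> = (descend lab ^^ pi2 m) ?z"
    proof (rule funpow_stable[of ?\<mu> "descend lab"])
      have "pi2 m \<le> m" by (rule prod_decode_le)
      then show "?\<mu> ?z \<le> m" by simp
      show "?\<mu> ?z \<le> pi2 m" by simp
    qed (use stop dec in blast)+
    finally show ?thesis by (simp add: bcode_def Suc tuple_def)
  qed
qed

lemma comp_fun_bcode:
  assumes lab: "\<And>f g. comp_fun f \<Longrightarrow> comp_fun g \<Longrightarrow> comp_fun (\<lambda>s z. lab s (f s z) (g s z))"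
    and opn: "\<And>f g. comp_fun f \<Longrightarrow> comp_fun g \<Longrightarrow> comp_fun (\<lambda>s z. opn (f s z) (g s z))"
  shows "comp_fun (\<lambda>s k. bcode (lab s) opn st k)"
  unfolding bcode_def descend_def child_def
  by (intro comp_fun_intros dec_pred_extends lab opn)

text \<open>All proper ancestors of a live node are known from \<open>e\<close> to be inner nodes.
  Elsewhere a path need not lead to a subcode at all.\<close>

inductive live :: "(nat \<Rightarrow> nat \<Rightarrow> nat) \<Rightarrow> nat \<Rightarrow> nat \<Rightarrow> bool" for lab e where
  root: "live lab e 0"
| child: "live lab e w \<Longrightarrow> 2 \<le> lab e w \<Longrightarrow> live lab e (Suc (pr i w))"

lemma live_Suc: "live lab e (Suc (pr i w)) \<longleftrightarrow> live lab e w \<and> 2 \<le> lab e w"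
  by (auto intro: live.child elim: live.cases)

lemma BC_value_children:
  assumes "BC_value y b" "y 0 \<noteq> 0"
  obtains v where "\<And>i. BC_value (\<lambda>j. y (Suc (pr i j))) (v i)" "b \<longleftrightarrow> (\<exists>i. \<not> v i)"
  using assms(1)
proof cases
  case (step ps v)
  have "(\<lambda>j. y (Suc (pr i j))) = ps i" for i by (simp add: step tuple_def)
  then show ?thesis using step that[of v] by simp
qed (use assms(2) in simp)

text \<open>Evaluation is an inductive relation: a leaf ends the path at once, and at an inner node
  the tail of the path lies in a child.\<close>

lemma BC_value_no_infinite_path:
  assumes "BC_value y b" "Y 0 = y" "\<And>k. Y (Suc k) = (\<lambda>j. Y k (Suc (pr (i k) j)))"
  shows "\<exists>k. Y k 0 = (0::nat)"
  using assms
proof (induction arbitrary: Y i rule: BC_value.induct)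
  case (zero p)
  then show ?case by (intro exI[of _ 0]) simp
next
  case (step ps v)
  have "Y 1 = ps (i 0)" using step.prems(2)[of 0] step.prems(1) by (simp add: tuple_def)
  then have "\<exists>k. Y (Suc k) 0 = 0"
    by (intro step.IH[where Y = "\<lambda>k. Y (Suc k)"]) (simp, rule step.prems(2))
  then show ?case by blast
qed

lemma borel_rep_subset: "borel_rep \<delta> c A \<Longrightarrow> A \<subseteq> points \<delta>"
  by (cases rule: borel_rep.cases) (auto simp: open_rep_def)

section \<open>Forcing\<close>

text \<open>Collects what forcing requires, so that machines disappear: \<open>lab\<close>
  approximates the labels of the codes \<open>G q\<close>, and \<open>opn e\<close> names the image
  of the cylinder of \<open>e\<close>.\<close>

locale vaught_transform =
  fixes \<delta>\<^sub>X :: "'a rep" and dl :: "baire \<Rightarrow> 'a" and G :: "baire \<Rightarrow> baire"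
    and lab :: "nat \<Rightarrow> nat \<Rightarrow> nat" and opn :: "nat \<Rightarrow> baire" and f :: "'a \<Rightarrow> bool"
  assumes points: "points \<delta>\<^sub>X = range dl"
    and T0: "T0_rep \<delta>\<^sub>X"
    and opn: "open_rep \<delta>\<^sub>X (opn e) (dl ` {q. is_prefix e q})"
    and continuous: "U \<in> points (open_rep \<delta>\<^sub>X) \<Longrightarrow> dl q \<in> U \<Longrightarrow>
      \<exists>m. \<forall>q'. (\<forall>i<m. q' i = q i) \<longrightarrow> dl q' \<in> U"
    and label_sound: "lab e w = Suc v \<Longrightarrow> is_prefix e q \<Longrightarrow> G q (path_pos w 0) = v"
    and label_limit: "\<exists>m. \<forall>e. is_prefix e q \<longrightarrow> m \<le> plen e \<longrightarrow> lab e w = Suc (G q (path_pos w 0))"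
    and label_mono: "lab e w \<noteq> 0 \<Longrightarrow> extends e' e \<Longrightarrow> lab e' w = lab e w"
    and val: "BC_value (G q) (f (dl q))"
begin

section \<open>The Borel sets coded by the states\<close>

abbreviation cyl :: "nat \<Rightarrow> 'a set" where "cyl e \<equiv> dl ` {q. is_prefix e q}"

definition coded :: "nat \<Rightarrow> bool" where
  "coded st \<longleftrightarrow> (\<exists>A. borel_rep \<delta>\<^sub>X (bcode lab opn st) A)"

definition mem :: "nat \<Rightarrow> 'a \<Rightarrow> bool" where
  "mem st x \<longleftrightarrow> (\<exists>A. borel_rep \<delta>\<^sub>X (bcode lab opn st) A \<and> x \<in> A)"

lemma mem_iff: "borel_rep \<delta>\<^sub>X (bcode lab opn st) A \<Longrightarrow> mem st x \<longleftrightarrow> x \<in> A"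
  unfolding mem_def using right_uniqueD[OF right_unique_borel_rep] by metis

lemma node_state:
  assumes "\<And>i. coded (child lab st i)" "\<not> 3 < pi1 st"
  shows "coded st" and "x \<in> points \<delta>\<^sub>X \<Longrightarrow> mem st x \<longleftrightarrow> (\<forall>i. \<not> mem (child lab st i) x)"
proof -
  define A where "A i = (SOME A. borel_rep \<delta>\<^sub>X (bcode lab opn (child lab st i)) A)" for i
  have A: "borel_rep \<delta>\<^sub>X (bcode lab opn (child lab st i)) (A i)" for i
    unfolding A_def using assms(1)[unfolded coded_def] by (rule someI_ex)
  have B: "borel_rep \<delta>\<^sub>X (bcode lab opn st) (points \<delta>\<^sub>X - (\<Union>i. A i))"
    unfolding bcode_node[OF assms(2)] by (rule borel_rep.compl_Union) (rule A)
  show "coded st" unfolding coded_def using B by (rule exI)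
  show "mem st x \<longleftrightarrow> (\<forall>i. \<not> mem (child lab st i) x)" if "x \<in> points \<delta>\<^sub>X"
    using that by (simp add: mem_iff[OF B] mem_iff[OF A])
qed

lemma coded_L: "coded (state 4 e w)" and mem_L: "mem (state 4 e w) x \<longleftrightarrow> x \<in> cyl e"
proof -
  have B: "borel_rep \<delta>\<^sub>X (bcode lab opn (state 4 e w)) (cyl e)"
    using borel_rep.opn[OF opn, of e] by (simp add: bcode_leaf)
  show "coded (state 4 e w)" unfolding coded_def using B by (rule exI)
  show "mem (state 4 e w) x \<longleftrightarrow> x \<in> cyl e" by (rule mem_iff[OF B])
qed

lemma child_C: "child lab (state 3 e w) i = state 4 e w"
  by (simp add: child_def)

lemma coded_C: "coded (state 3 e w)"
  by (rule node_state(1)) (simp_all add: child_C coded_L)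

lemma mem_C: "x \<in> points \<delta>\<^sub>X \<Longrightarrow> mem (state 3 e w) x \<longleftrightarrow> x \<notin> cyl e"
  by (subst node_state(2)) (simp_all add: child_C coded_L mem_L)

lemma child_T: "child lab (state 2 e w) 0 = state 3 e w"
  "child lab (state 2 e w) (Suc i) = (if lab e w < 2 then state 4 e w else state 0 e (Suc (pr i w)))"
  by (simp_all add: child_def)

lemma forcing_state:
  assumes "2 \<le> lab e w \<Longrightarrow> \<forall>i. coded (state 0 e (Suc (pr i w)))"
  shows "coded (state 2 e w)"
    and "x \<in> points \<delta>\<^sub>X \<Longrightarrow> mem (state 2 e w) x \<longleftrightarrow>
      x \<in> cyl e \<and> 2 \<le> lab e w \<and> (\<forall>i. \<not> mem (state 0 e (Suc (pr i w))) x)"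
proof -
  have ch: "coded (child lab (state 2 e w) i)" for i
  proof (cases i)
    case 0
    then show ?thesis by (simp only: child_T coded_C)
  next
    case (Suc j)
    then show ?thesis unfolding Suc child_T using assms coded_L by (auto simp: not_less)
  qed
  show "coded (state 2 e w)" by (rule node_state(1)) (simp_all add: ch)
  have all: "(\<forall>i. P i) \<longleftrightarrow> P 0 \<and> (\<forall>i. P (Suc i))" for P :: "nat \<Rightarrow> bool"
    using nat.exhaust by metis
  show "mem (state 2 e w) x \<longleftrightarrow>
      x \<in> cyl e \<and> 2 \<le> lab e w \<and> (\<forall>i. \<not> mem (state 0 e (Suc (pr i w))) x)"
    if x: "x \<in> points \<delta>\<^sub>X"
  proof -
    have "mem (state 2 e w) x \<longleftrightarrow> (\<forall>i. \<not> mem (child lab (state 2 e w) i) x)"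
      by (rule node_state(2)[OF ch _ x]) simp
    also have "\<dots> \<longleftrightarrow> x \<in> cyl e \<and> (\<forall>i. \<not> mem (child lab (state 2 e w) (Suc i)) x)"
      by (subst all) (simp only: child_T mem_C[OF x] not_not)
    finally show ?thesis
      unfolding child_T using mem_L by (auto simp: not_less)
  qed
qed

lemma quantified_state:
  assumes "\<And>e'. extends e' e \<Longrightarrow> coded (state 2 e' w)"
  shows "coded (state (Suc 0) e w)" and "coded (state 0 e w)"
    and "x \<in> points \<delta>\<^sub>X \<Longrightarrow> mem (state (Suc 0) e w) x \<longleftrightarrow> \<not> (\<exists>e'. extends e' e \<and> mem (state 2 e' w) x)"
    and "x \<in> points \<delta>\<^sub>X \<Longrightarrow> mem (state 0 e w) x \<longleftrightarrow> (\<exists>e'. extends e' e \<and> mem (state 2 e' w) x)"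
proof -
  have chM: "child lab (state (Suc 0) e w) i = state 2 (if extends i e then i else e) w" for i
    by (simp add: child_def)
  have coM: "coded (child lab (state (Suc 0) e w) i)" for i
    unfolding chM using assms extends_refl by simp
  have chV: "child lab (state 0 e w) i = state (Suc 0) e w" for i
    by (simp add: child_def)
  show M: "coded (state (Suc 0) e w)" by (rule node_state(1)) (simp_all add: coM)
  show "coded (state 0 e w)" by (rule node_state(1)) (simp_all add: chV M)
  show *: "mem (state (Suc 0) e w) x \<longleftrightarrow> \<not> (\<exists>e'. extends e' e \<and> mem (state 2 e' w) x)"
    if x: "x \<in> points \<delta>\<^sub>X" for x
  proof -
    have "mem (state (Suc 0) e w) x \<longleftrightarrow> (\<forall>i. \<not> mem (state 2 (if extends i e then i else e) w) x)"
      by (subst node_state(2)[OF coM _ x]) (simp_all only: chM, simp)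
    then show ?thesis using extends_refl[of e] by (auto split: if_splits)
  qed
  show "mem (state 0 e w) x \<longleftrightarrow> (\<exists>e'. extends e' e \<and> mem (state 2 e' w) x)"
    if x: "x \<in> points \<delta>\<^sub>X"
    by (subst node_state(2)[OF _ _ x]) (simp_all add: chV M *[OF x])
qed

section \<open>Well-foundedness of the unfolding\<close>

lemma live_mono:
  assumes "live lab e w" "extends e' e" shows "live lab e' w"
  using assms(1)
proof induction
  case (child w i)
  then have "lab e' w = lab e w" using label_mono[OF _ assms(2)] by simp
  then show ?case using child by (intro live.child) simp_all
qed (rule live.root)

definition subcode :: "baire \<Rightarrow> nat \<Rightarrow> baire" where
  "subcode p w = (\<lambda>j. G p (path_pos w j))"

lemma subcode_Suc: "subcode p (Suc (pr i w)) = (\<lambda>j. subcode p w (Suc (pr i j)))"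
  by (simp add: subcode_def path_pos_Suc)

lemma live_BC_value:
  assumes "live lab e w" "is_prefix e p" shows "\<exists>b. BC_value (subcode p w) b"
  using assms(1)
proof induction
  case root
  have "subcode p 0 = G p" by (simp add: subcode_def path_pos_0)
  then show ?case using val by metis
next
  case (child w i)
  obtain b where b: "BC_value (subcode p w) b" using child.IH by blast
  obtain v where "lab e w = Suc v" "v \<noteq> 0" using child.hyps(2) by (cases "lab e w") auto
  then have "subcode p w 0 \<noteq> 0" using label_sound assms(2) by (simp add: subcode_def)
  then obtain v where "\<And>i. BC_value (\<lambda>j. subcode p w (Suc (pr i j))) (v i)"
    using BC_value_children[OF b] by metis
  then show ?case unfolding subcode_Suc by (intro exI[of _ "v i"])
qed

text \<open>An uncoded state with tag \<open>0\<close> has an uncoded state of the same kind below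
  it, with a longer or equal prefix and a child of the node. Iterating, the prefixes converge to
  some \<open>p\<close> and the nodes form an infinite path through \<open>G p\<close>, which has a
  value.\<close>

lemma coded_V:
  assumes "live lab e w" shows "coded (state 0 e w)"
proof (rule ccontr)
  assume "\<not> coded (state 0 e w)"
  define bad where "bad z \<longleftrightarrow> live lab (pi1 z) (pi2 z) \<and> \<not> coded (state 0 (pi1 z) (pi2 z))" for z
  have step: "\<exists>z'. bad z' \<and> (extends (pi1 z') (pi1 z) \<and> 2 \<le> lab (pi1 z') (pi2 z) \<and>
      (\<exists>i. pi2 z' = Suc (pr i (pi2 z))))" if bz: "bad z" for z
  proof -
    obtain e' where e': "extends e' (pi1 z)" "\<not> coded (state 2 e' (pi2 z))"
      using quantified_state(2)[of "pi1 z" "pi2 z"] bz unfolding bad_def by blast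
    obtain i where i: "2 \<le> lab e' (pi2 z)" "\<not> coded (state 0 e' (Suc (pr i (pi2 z))))"
      using forcing_state(1)[of e' "pi2 z"] e'(2) by blast
    have "live lab e' (pi2 z)" using live_mono[OF _ e'(1)] bz unfolding bad_def by blast
    then have "bad (pr e' (Suc (pr i (pi2 z))))" unfolding bad_def using i by (simp add: live_Suc)
    then show ?thesis using e'(1) i(1) by (intro exI[of _ "pr e' (Suc (pr i (pi2 z)))"]) simp
  qed
  have "bad (pr e w)" using assms \<open>\<not> coded (state 0 e w)\<close> by (simp add: bad_def)
  then obtain z where z: "z 0 = pr e w" "\<And>k. bad (z k)"
    "\<And>k. extends (pi1 (z (Suc k))) (pi1 (z k)) \<and> 2 \<le> lab (pi1 (z (Suc k))) (pi2 (z k)) \<and>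
      (\<exists>i. pi2 (z (Suc k)) = Suc (pr i (pi2 (z k))))"
    using dependent_nat_choice[of "\<lambda>k z. bad z \<and> (k = 0 \<longrightarrow> z = pr e w)"
        "\<lambda>k z z'. extends (pi1 z') (pi1 z) \<and> 2 \<le> lab (pi1 z') (pi2 z) \<and> (\<exists>i. pi2 z' = Suc (pr i (pi2 z)))"]
      step by (metis nat.distinct(1))
  obtain p where p: "\<And>k. is_prefix (pi1 (z k)) p"
    using extends_limit[of "\<lambda>k. pi1 (z k)"] z(3) by blast
  define Y where "Y k = subcode p (pi2 (z k))" for k
  have "\<exists>i. Y (Suc k) = (\<lambda>j. Y k (Suc (pr i j)))" for k
    unfolding Y_def using z(3)[of k] subcode_Suc by metis
  then obtain i where Y: "\<And>k. Y (Suc k) = (\<lambda>j. Y k (Suc (pr (i k) j)))" by metis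
  obtain b where b: "BC_value (Y 0) b"
    unfolding Y_def using live_BC_value[of "pi1 (z 0)" "pi2 (z 0)" p] z(2)[of 0] p bad_def by blast
  have "\<exists>k. Y k 0 = 0"
    by (rule BC_value_no_infinite_path[where Y = Y and i = i, OF b refl Y])
  then obtain k where k: "Y k 0 = 0" by blast
  \<comment> \<open>The next prefix in the sequence certifies that the \<open>k\<close>-th node is
    inner, contradicting its label \<open>0\<close>.\<close>
  obtain v where v: "lab (pi1 (z (Suc k))) (pi2 (z k)) = Suc v" "v \<noteq> 0"
    using z(3)[of k] by (cases "lab (pi1 (z (Suc k))) (pi2 (z k))") auto
  have "Y k 0 = v" unfolding Y_def subcode_def by (rule label_sound[OF v(1) p])
  then show False using k v(2) by simp
qed

lemma mem_T:
  assumes "live lab e w" "x \<in> points \<delta>\<^sub>X"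
  shows "mem (state 2 e w) x \<longleftrightarrow>
      x \<in> cyl e \<and> 2 \<le> lab e w \<and> (\<forall>i. \<not> mem (state 0 e (Suc (pr i w))) x)"
proof (rule forcing_state(2)[OF _ assms(2)])
  show "\<forall>i. coded (state 0 e (Suc (pr i w)))" if "2 \<le> lab e w"
    using that assms(1) by (intro allI coded_V) (simp add: live_Suc)
qed

lemma coded_T:
  assumes "live lab e w" "extends e' e" shows "coded (state 2 e' w)"
proof (rule forcing_state(1))
  show "\<forall>i. coded (state 0 e' (Suc (pr i w)))" if "2 \<le> lab e' w"
    using that live_mono[OF assms] by (intro allI coded_V) (simp add: live_Suc)
qed

lemma mem_V:
  assumes "live lab e w" "x \<in> points \<delta>\<^sub>X"
  shows "mem (state 0 e w) x \<longleftrightarrow> (\<exists>e'. extends e' e \<and> mem (state 2 e' w) x)"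
  by (rule quantified_state(4)[OF coded_T[OF assms(1)] assms(2)])

section \<open>Generic names in a fibre\<close>

lemma open_cyl: "cyl e \<in> points (open_rep \<delta>\<^sub>X)"
  unfolding points_def using opn by blast

lemma open_prefix:
  assumes "U \<in> points (open_rep \<delta>\<^sub>X)" "dl q \<in> U"
  shows "\<exists>m. \<forall>e. is_prefix e q \<longrightarrow> m \<le> plen e \<longrightarrow> cyl e \<subseteq> U"
proof -
  obtain m where m: "\<And>q'. \<forall>i<m. q' i = q i \<Longrightarrow> dl q' \<in> U"
    using continuous[OF assms] by blast
  have "cyl e \<subseteq> U" if "is_prefix e q" "m \<le> plen e" for e
  proof clarify
    fix q' assume "is_prefix e q'"
    then have "\<forall>i<m. q' i = q i" using that by (simp add: is_prefix_def)
    then show "dl q' \<in> U" by (rule m)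
  qed
  then show ?thesis by blast
qed

text \<open>First \<open>D\<close> is met by some \<open>d\<close>; then \<open>d\<close> is
  prolonged along a name \<open>q\<close> of \<open>x\<close>. This keeps \<open>x\<close> in the
  image while continuity of \<open>dl\<close> shrinks the image into \<open>cyl k\<close>.\<close>

lemma generic_step:
  assumes "x \<in> cyl e" and dense: "\<And>e. x \<in> cyl e \<Longrightarrow> \<exists>e'. extends e' e \<and> x \<in> cyl e' \<and> D e'"
  shows "\<exists>e'. x \<in> cyl e' \<and> extends e' e \<and> (\<exists>d. extends e' d \<and> D d) \<and> k \<le> plen e' \<and>
    (x \<in> cyl k \<longrightarrow> cyl e' \<subseteq> cyl k)"
proof -
  obtain d where d: "extends d e" "x \<in> cyl d" "D d" using dense[OF assms(1)] by blast
  obtain q where q: "is_prefix d q" "x = dl q" using d(2) by blast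
  obtain m where m: "x \<in> cyl k \<Longrightarrow> \<forall>e. is_prefix e q \<longrightarrow> m \<le> plen e \<longrightarrow> cyl e \<subseteq> cyl k"
    using open_prefix[OF open_cyl, of q k] q(2) by blast
  obtain e' where e': "plen e' = max m (max k (plen d))" "is_prefix e' q"
    using prefix_exists by blast
  have "extends e' d" using prefix_linear[OF q(1) e'(2)] e'(1) by simp
  moreover have "x \<in> cyl e'" using e'(2) q(2) by blast
  moreover have "cyl e' \<subseteq> cyl k" if "x \<in> cyl k" using m[OF that] e' by simp
  ultimately show ?thesis
    using d e'(1) extends_trans[of e' d e] by (intro exI[of _ e'] conjI exI[of _ d] impI) simp_all
qed

text \<open>The fibre over \<open>x\<close> is a Baire space: as the sets \<open>cyl k\<close> form a basis of a \<open>T0\<close> topology,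
  meeting the conditions for all \<open>k\<close> forces the limit into the fibre.\<close>

lemma generic_exists:
  fixes D :: "nat \<Rightarrow> nat \<Rightarrow> bool"
  assumes "x \<in> cyl e"
    and dense: "\<And>k e. x \<in> cyl e \<Longrightarrow> \<exists>e'. extends e' e \<and> x \<in> cyl e' \<and> D k e'"
  shows "\<exists>p. is_prefix e p \<and> dl p = x \<and> (\<forall>k. \<exists>e'. is_prefix e' p \<and> D k e')"
proof -
  define R where "R k a b \<longleftrightarrow> extends b a \<and> (\<exists>d. extends b d \<and> D k d) \<and> k \<le> plen b \<and>
    (x \<in> cyl k \<longrightarrow> cyl b \<subseteq> cyl k)" for k :: nat and a b
  have "\<exists>b. x \<in> cyl b \<and> R k a b" if "x \<in> cyl a" for a k
    unfolding R_def by (rule generic_step[OF that dense])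
  then obtain c where c: "c 0 = e" "\<And>k. x \<in> cyl (c k)" "\<And>k. R k (c k) (c (Suc k))"
    using dependent_nat_choice[of "\<lambda>k a. x \<in> cyl a \<and> (k = 0 \<longrightarrow> a = e)" "\<lambda>k a b. R k a b"] assms(1)
    by (metis nat.distinct(1))
  obtain p where p: "\<And>k. is_prefix (c k) p"
    using extends_limit[of c] c(3) unfolding R_def by blast
  have fibre: "dl p = x"
  proof (rule ccontr)
    assume "dl p \<noteq> x"
    moreover have "dl p \<in> points \<delta>\<^sub>X" "x \<in> points \<delta>\<^sub>X" using points assms(1) by auto
    ultimately obtain U where U: "U \<in> points (open_rep \<delta>\<^sub>X)" "(x \<in> U) \<noteq> (dl p \<in> U)"
      using T0 unfolding T0_rep_def by metis
    show False
    proof (cases "x \<in> U")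
      case True
      obtain q where q: "is_prefix e q" "x = dl q" using assms(1) by blast
      obtain m where m: "\<forall>e. is_prefix e q \<longrightarrow> m \<le> plen e \<longrightarrow> cyl e \<subseteq> U"
        using open_prefix[OF U(1), of q] True q(2) by blast
      \<comment> \<open>The prefix \<open>k\<close> gives a basic neighbourhood of \<open>x\<close>
        inside \<open>U\<close>; stage \<open>k\<close> of the construction has placed
        \<open>dl p\<close> in it.\<close>
      obtain k where k: "plen k = m" "is_prefix k q" using prefix_exists by blast
      have "cyl (c (Suc k)) \<subseteq> cyl k" using c(3)[of k] k(2) q(2) unfolding R_def by blast
      then have "dl p \<in> cyl k" using p[of "Suc k"] by blast
      then have "dl p \<in> U" using m k by blast
      then show False using U(2) True by simp
    next
      case False
      then have "dl p \<in> U" using U(2) by simp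
      \<comment> \<open>Here a long prefix of \<open>p\<close> has its image in \<open>U\<close>,
        and \<open>x\<close> lies in the image of every \<open>c k\<close>.\<close>
      then obtain m where m: "\<forall>e. is_prefix e p \<longrightarrow> m \<le> plen e \<longrightarrow> cyl e \<subseteq> U"
        using open_prefix[OF U(1)] by blast
      have "cyl (c (Suc m)) \<subseteq> U" using m p[of "Suc m"] c(3)[of m] unfolding R_def by blast
      then show False using c(2)[of "Suc m"] False by blast
    qed
  qed
  have "\<exists>e'. is_prefix e' p \<and> D k e'" for k
    using c(3)[of k] p[of "Suc k"] is_prefix_extends unfolding R_def by blast
  then show ?thesis using p[of 0] c(1) fibre by auto
qed

text \<open>The dense requirement at \<open>w\<close>: either \<open>w\<close> never becomes a live
  inner node over \<open>x\<close>, or \<open>e\<close> forces \<open>w\<close> or one of its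
  children to be false.\<close>

definition decides :: "'a \<Rightarrow> nat \<Rightarrow> nat \<Rightarrow> bool" where
  "decides x w e \<longleftrightarrow>
    (\<forall>e'. extends e' e \<longrightarrow> x \<in> cyl e' \<longrightarrow> \<not> (live lab e' w \<and> 2 \<le> lab e' w)) \<or>
    live lab e w \<and> 2 \<le> lab e w \<and>
      (mem (state 2 e w) x \<or> (\<exists>i. mem (state 2 e (Suc (pr i w))) x))"

lemma decides_dense:
  assumes "x \<in> cyl e" shows "\<exists>e'. extends e' e \<and> x \<in> cyl e' \<and> decides x w e'"
proof (cases "\<exists>e'. extends e' e \<and> x \<in> cyl e' \<and> live lab e' w \<and> 2 \<le> lab e' w")
  case False
  then have "decides x w e" unfolding decides_def by blast
  then show ?thesis using assms extends_refl by blast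
next
  case True
  then obtain a where a: "extends a e" "x \<in> cyl a" "live lab a w" "2 \<le> lab a w" by blast
  have x: "x \<in> points \<delta>\<^sub>X" using points assms by auto
  have live: "live lab a (Suc (pr i w))" for i using a by (simp add: live_Suc)
  show ?thesis
  \<comment> \<open>If no extension forces a child to be false, then \<open>a\<close> itself forces
    \<open>w\<close> to be false; otherwise an extension forcing a child decides
    \<open>w\<close>.\<close>
  proof (cases "\<forall>i. \<not> mem (state 0 a (Suc (pr i w))) x")
    case True
    then have "mem (state 2 a w) x" using mem_T[OF a(3) x] a(2,4) by simp
    then have "decides x w a" unfolding decides_def using a(3,4) by blast
    then show ?thesis using a(1,2) by blast
  next
    case False
    then obtain i b where b: "extends b a" "mem (state 2 b (Suc (pr i w))) x"
      using mem_V[OF live x] by blast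
    have lb: "live lab b (Suc (pr i w))" using live_mono[OF live b(1)] .
    then have "x \<in> cyl b" using mem_T[OF lb x] b(2) by blast
    moreover have "decides x w b" unfolding decides_def using lb b(2) live_Suc by blast
    ultimately show ?thesis using extends_trans[OF b(1) a(1)] by blast
  qed
qed

section \<open>Truth along decisive names\<close>

lemma decisive_exists:
  assumes "x \<in> cyl e"
  shows "\<exists>p. is_prefix e p \<and> dl p = x \<and> (\<forall>w. \<exists>e'. is_prefix e' p \<and> decides x w e')"
  by (rule generic_exists[where D = "decides x", OF assms decides_dense])

text \<open>The condition on the children ranges over extensions, of which \<open>e'\<close> has no
  more than \<open>e\<close>; the label persists by \<open>label_mono\<close>.\<close>

lemma forces_mono:
  assumes "mem (state 2 e w) x" "extends e' e" "x \<in> cyl e'" "live lab e w"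
  shows "mem (state 2 e' w) x"
proof -
  have x: "x \<in> points \<delta>\<^sub>X" using points assms(3) by auto
  have T: "2 \<le> lab e w" "\<And>i. \<not> mem (state 0 e (Suc (pr i w))) x"
    using assms(1)[unfolded mem_T[OF assms(4) x]] by blast+
  have lab: "lab e' w = lab e w" using label_mono[OF _ assms(2)] T by simp
  have l': "live lab e' w" by (rule live_mono[OF assms(4,2)])
  have "\<not> mem (state 0 e' (Suc (pr i w))) x" for i
  proof
    assume m: "mem (state 0 e' (Suc (pr i w))) x"
    have l: "live lab e (Suc (pr i w))" "live lab e' (Suc (pr i w))"
      using assms(4) l' lab T by (simp_all add: live_Suc)
    have "mem (state 0 e (Suc (pr i w))) x"
      using m mem_V[OF l(1) x] mem_V[OF l(2) x] extends_trans[OF _ assms(2)] by blast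
    then show False using T by blast
  qed
  then show ?thesis using mem_T[OF l' x] assms(3) T(1) lab by auto
qed

text \<open>Induction on the evaluation. A node is false exactly when all its children are true;
  genericity then supplies a forcing prefix. The converse compares prefixes of \<open>p\<close> and
  uses \<open>forces_mono\<close>.\<close>

lemma truth:
  assumes "BC_value y b" "y = subcode p w" "is_prefix e p" "live lab e w"
    and x: "dl p = x" and gen: "\<And>w. \<exists>e'. is_prefix e' p \<and> decides x w e'"
  shows "\<not> b \<longleftrightarrow> (\<exists>e'. is_prefix e' p \<and> live lab e' w \<and> mem (state 2 e' w) x)"
  using assms(1-4)
proof (induction arbitrary: w e rule: BC_value.induct)
  case (zero y)
  have "subcode p w 0 = 0" using zero.prems(1) by (metis nat.case(1))
  moreover have "x \<in> points \<delta>\<^sub>X" using points x by auto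
  moreover have "lab e' w < 2" if e': "is_prefix e' p" for e'
  proof (cases "lab e' w")
    case (Suc v)
    then show ?thesis using label_sound[OF Suc e'] \<open>subcode p w 0 = 0\<close> by (simp add: subcode_def)
  qed simp
  ultimately show ?case using mem_T by (auto simp: not_le)
next
  case (step ps v)
  have xp: "x \<in> points \<delta>\<^sub>X" using points x by auto
  have xc: "x \<in> cyl e" if "is_prefix e p" for e using that x by blast
  obtain m where m: "\<And>e. is_prefix e p \<Longrightarrow> m \<le> plen e \<Longrightarrow> lab e w = Suc (G p (path_pos w 0))"
    using label_limit by blast
  \<comment> \<open>\<open>a\<close> prolongs \<open>e\<close> far enough along \<open>p\<close> to
    determine the label of \<open>w\<close>.\<close>
  obtain a where a: "plen a = max m (plen e)" "is_prefix a p" using prefix_exists by blast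
  have "subcode p w 0 = 1" using step.prems(1) by (metis nat.case(1))
  then have lab: "lab a w = 2" using m[OF a(2)] a(1) by (simp add: subcode_def)
  have live: "live lab a w"
    using live_mono[OF step.prems(3)] prefix_linear[OF step.prems(2) a(2)] a(1) by simp
  have lc: "live lab a (Suc (pr i w))" for i using live lab by (simp add: live_Suc)
  have ps: "ps i = subcode p (Suc (pr i w))" for i
    unfolding subcode_Suc step.prems(1)[symmetric] by (simp add: tuple_def)
  have IH: "\<not> v i \<longleftrightarrow>
      (\<exists>e'. is_prefix e' p \<and> live lab e' (Suc (pr i w)) \<and> mem (state 2 e' (Suc (pr i w))) x)" for i
    by (rule step.IH[OF ps a(2) lc])
  show ?case
  proof
    assume "\<not> (\<exists>i. \<not> v i)"
    obtain e' where e': "is_prefix e' p" "decides x w e'" using gen by blast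
    \<comment> \<open>As \<open>a\<close> and \<open>e'\<close> are comparable, \<open>w\<close> is
      a live inner node at some extension of \<open>e'\<close> over \<open>x\<close>, which rules
      out the first alternative of \<open>decides\<close>.\<close>
    have "\<exists>d. extends d e' \<and> x \<in> cyl d \<and> live lab d w \<and> 2 \<le> lab d w"
      using prefix_amalgam[OF a(2) e'(1)]
    proof
      assume "extends e' a"
      then have "live lab e' w" "lab e' w = 2"
        using live_mono[OF live] label_mono[of a w e'] lab by simp_all
      then show ?thesis using extends_refl xc[OF e'(1)] by (intro exI[of _ e']) simp
    next
      assume "extends a e'"
      then show ?thesis using live lab xc[OF a(2)] by (intro exI[of _ a]) simp
    qed
    then have d: "live lab e' w" "2 \<le> lab e' w"
      "mem (state 2 e' w) x \<or> (\<exists>i. mem (state 2 e' (Suc (pr i w))) x)"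
      using e'(2) unfolding decides_def by blast+
    have "\<not> mem (state 2 e' (Suc (pr i w))) x" for i
    proof
      assume "mem (state 2 e' (Suc (pr i w))) x"
      moreover have "live lab e' (Suc (pr i w))" using d by (simp add: live_Suc)
      ultimately have "\<not> v i" using IH e'(1) by blast
      then show False using \<open>\<not> (\<exists>i. \<not> v i)\<close> by blast
    qed
    then show "\<exists>e'. is_prefix e' p \<and> live lab e' w \<and> mem (state 2 e' w) x"
      using d e'(1) by blast
  next
    assume "\<exists>e'. is_prefix e' p \<and> live lab e' w \<and> mem (state 2 e' w) x"
    then obtain e' where e': "is_prefix e' p" "live lab e' w" "mem (state 2 e' w) x" by blast
    have T: "2 \<le> lab e' w" "\<And>i. \<not> mem (state 0 e' (Suc (pr i w))) x"
      using e'(3)[unfolded mem_T[OF e'(2) xp]] by blast+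
    show "\<not> (\<exists>i. \<not> v i)"
    proof
      assume "\<exists>i. \<not> v i"
      then obtain i where "\<not> v i" by blast
      then obtain d where d: "is_prefix d p" "live lab d (Suc (pr i w))" "mem (state 2 d (Suc (pr i w))) x"
        using IH by blast
      have l: "live lab e' (Suc (pr i w))" using e'(2) T(1) by (simp add: live_Suc)
      \<comment> \<open>The prefix forcing the child to be false can be taken to extend
        \<open>e'\<close>, which contradicts the forcing of \<open>w\<close> by
        \<open>e'\<close>.\<close>
      have "\<exists>c. extends c e' \<and> mem (state 2 c (Suc (pr i w))) x"
        using prefix_amalgam[OF d(1) e'(1)]
      proof
        assume "extends e' d"
        then have "mem (state 2 e' (Suc (pr i w))) x" using forces_mono[OF d(3) _ xc[OF e'(1)] d(2)] by blast
        then show ?thesis using extends_refl by blast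
      next
        assume "extends d e'"
        then show ?thesis using d(3) by blast
      qed
      then have "mem (state 0 e' (Suc (pr i w))) x" using mem_V[OF l xp] by blast
      then show False using T(2) by blast
    qed
  qed
qed

text \<open>Prefix \<open>0\<close> is the empty sequence and path \<open>0\<close> the whole code;
  tag \<open>1\<close> because \<open>f x\<close> holds when no prefix forces the root to be
  false.\<close>

abbreviation root :: nat where "root \<equiv> state (Suc 0) 0 0"

lemma borel_code: "borel_rep \<delta>\<^sub>X (bcode lab opn root) {x \<in> points \<delta>\<^sub>X. f x}"
proof -
  have len0: "plen 0 = 0" using prod_decode_le(1)[of 0] by simp
  have ext0: "extends e 0" and pre0: "is_prefix 0 p" for e p
    by (simp_all add: extends_def is_prefix_def len0)
  have coT: "\<And>e'. extends e' 0 \<Longrightarrow> coded (state 2 e' 0)"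
    by (rule coded_T[OF live.root])
  have truth': "\<not> f x \<longleftrightarrow> (\<exists>e. is_prefix e p \<and> live lab e 0 \<and> mem (state 2 e 0) x)"
    if "dl p = x" "\<And>w. \<exists>e'. is_prefix e' p \<and> decides x w e'" for x p
  proof (rule truth[OF val[of p, unfolded that(1)] _ pre0 live.root that])
    show "G p = subcode p 0" by (simp add: subcode_def path_pos_0)
  qed
  have mem: "mem root x \<longleftrightarrow> f x" if x: "x \<in> points \<delta>\<^sub>X" for x
  proof
    assume m: "mem root x"
    have "x \<in> cyl 0" using x points pre0 by auto
    from decisive_exists[OF this]
    obtain p where "dl p = x" "\<And>w. \<exists>e'. is_prefix e' p \<and> decides x w e'" by metis
    then show "f x" using truth'[of p x] m quantified_state(3)[OF coT x] ext0 by blast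
  next
    assume fx: "f x"
    have "\<not> mem (state 2 e 0) x" for e
    proof
      assume m: "mem (state 2 e 0) x"
      then have "x \<in> cyl e" using mem_T[OF live.root x] by blast
      \<comment> \<open>The decisive name is chosen through \<open>e\<close> itself, so that the
        assumed forcing applies to it.\<close>
      from decisive_exists[OF this]
      obtain p where p: "is_prefix e p" "dl p = x" "\<And>w. \<exists>e'. is_prefix e' p \<and> decides x w e'" by metis
      have "\<not> f x" using truth'[OF p(2,3)] p(1) m live.root by blast
      then show False using fx by blast
    qed
    then show "mem root x" using quantified_state(3)[OF coT x] by blast
  qed
  obtain A where A: "borel_rep \<delta>\<^sub>X (bcode lab opn root) A"
    using quantified_state(1)[OF coT] unfolding coded_def by blast
  have "A = {x \<in> points \<delta>\<^sub>X. f x}"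
    using borel_rep_subset[OF A] mem mem_iff[OF A] by blast
  then show ?thesis using A by simp
qed

end

section \<open>Names of open sets\<close>

lemma machine_use:
  assumes "eval (code_of n) r x y"
  shows "\<exists>m. \<forall>r'. (\<forall>i<m. r' i = r i) \<longrightarrow> eval (code_of n) r' x y"
proof -
  obtain c where c: "certifies (\<lambda>i. Suc (r i)) n x c"
    using certifies_complete[OF assms, of "\<lambda>i. Suc (r i)"] by auto
  obtain m where m: "\<And>v. \<forall>i<m. Suc (r i) \<noteq> 0 \<longrightarrow> v i = Suc (r i) \<Longrightarrow> certifies v n x c"
    using certifies_use[OF c] by blast
  have "eval (code_of n) r x (cert_output c)" using c by (rule certifies_sound) simp
  then have y: "cert_output c = y" by (rule eval_deterministic[OF _ assms])
  have "eval (code_of n) r' x y" if "\<forall>i<m. r' i = r i" for r'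
  proof -
    have "certifies (\<lambda>i. Suc (r' i)) n x c" using that by (intro m) simp
    then show ?thesis unfolding y[symmetric] by (rule certifies_sound) simp
  qed
  then show ?thesis by blast
qed

lemma machine_continuous:
  assumes "\<And>q. machine n q = Some (E q)"
  shows "\<exists>M. \<forall>q'. (\<forall>i<M. q' i = q i) \<longrightarrow> (\<forall>i<m. E q' i = E q i)"
proof (induction m)
  case (Suc m)
  then obtain M where M: "\<And>q'. \<forall>i<M. q' i = q i \<Longrightarrow> \<forall>i<m. E q' i = E q i" by blast
  obtain N where N: "\<And>q'. \<forall>i<N. q' i = q i \<Longrightarrow> eval (code_of n) q' m (E q m)"
    using machine_use[OF machine_eq_SomeD[OF assms[of q], of m]] by blast
  have "E q' i = E q i" if q': "\<forall>i<max M N. q' i = q i" and i: "i < Suc m" for q' i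
  proof (cases "i = m")
    case True
    have "eval (code_of n) q' m (E q m)" using q' by (intro N) simp
    then show ?thesis unfolding True by (rule eval_deterministic[OF machine_eq_SomeD[OF assms]])
  next
    case False
    have "\<forall>i<m. E q' i = E q i" using q' by (intro M) simp
    then show ?thesis using False i by simp
  qed
  then show ?case by blast
qed simp

text \<open>A nonzero output of the machine for \<open>U\<close> depends on finitely many entries of
  \<open>E q\<close>, and these on finitely many entries of \<open>q\<close>.\<close>

lemma open_continuous:
  assumes E: "\<And>q. machine nE q = Some (E q)" "\<And>q. \<delta> (E q) (dl q)"
    and U: "U \<in> points (open_rep \<delta>)" "dl q \<in> U"
  shows "\<exists>m. \<forall>q'. (\<forall>i<m. q' i = q i) \<longrightarrow> dl q' \<in> U"
proof -
  obtain s where s: "open_rep \<delta> s U" using U(1) unfolding points_def by blast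
  then obtain n p where np: "realizes \<delta> sierpinski_rep (machine_with_oracle n p) (char_fun \<delta> U)"
    unfolding open_rep_def fun_rep_def by blast
  have mem: "char_fun \<delta> U (dl q) \<longleftrightarrow> dl q \<in> U" for q
    using E(2)[of q] unfolding char_fun_def points_def restrict_def by auto
  have "\<exists>r. machine n (join p (E q)) = Some r \<and> (dl q \<in> U) = (r \<noteq> (\<lambda>_. 0))" for q
    using np E(2)[of q] unfolding realizes_def machine_with_oracle_def sierpinski_rep_def mem[symmetric]
    by blast
  then obtain R where R: "\<And>q. machine n (join p (E q)) = Some (R q)"
    "\<And>q. dl q \<in> U \<longleftrightarrow> R q \<noteq> (\<lambda>_. 0)" by metis
  obtain k where k: "R q k \<noteq> 0" using R(2)[of q] U(2) by blast
  obtain m where m: "\<And>r'. \<forall>i<m. r' i = join p (E q) i \<Longrightarrow> eval (code_of n) r' k (R q k)"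
    using machine_use[OF machine_eq_SomeD[OF R(1)[of q], of k]] by blast
  obtain M where M: "\<And>q'. \<forall>i<M. q' i = q i \<Longrightarrow> \<forall>i<m. E q' i = E q i"
    using machine_continuous[where E = E, OF E(1), of q m] by blast
  have "dl q' \<in> U" if q': "\<forall>i<M. q' i = q i" for q'
  proof -
    have "\<forall>i<m. join p (E q') i = join p (E q) i" using M[OF q'] by (simp add: join_def)
    then have "eval (code_of n) (join p (E q')) k (R q k)" by (rule m)
    then have "R q' k = R q k" by (rule eval_deterministic[OF machine_eq_SomeD[OF R(1)]])
    then show ?thesis using k R(2)[of q'] by auto
  qed
  then show ?thesis by blast
qed

text \<open>One machine serves all cylinders: the oracle part of the name is constantly
  \<open>e\<close>, and the tested sequence sits at the odd positions of the join.\<close>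

lemma cylinder_names:
  "\<exists>n. \<forall>e. open_rep (=) (indexed n (\<lambda>_. e)) {q. is_prefix e q}"
proof -
  define h where "h r k = (if \<forall>i<plen (r 0). pentry (r 0) i = r (Suc (i + i)) then 1 else (0::nat))"
    for r :: baire and k :: nat
  have "comp_fun h" unfolding h_def by (intro comp_fun_intros comp_fun_entry)
  then obtain n where n: "\<And>r. machine n r = Some (h r)" using comp_fun_machine by blast
  have "open_rep (=) (indexed n (\<lambda>_. e)) {q. is_prefix e q}" for e
  proof -
    have j: "join (\<lambda>_. e) q 0 = e" "join (\<lambda>_. e) q (Suc (i + i)) = q i" for q i
      by (simp_all add: join_def)
    have "h (join (\<lambda>_. e) q) = (if is_prefix e q then (\<lambda>_. 1) else (\<lambda>_. 0))" for q
      unfolding h_def j is_prefix_def by auto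
    then have "(h (join (\<lambda>_. e) q) \<noteq> (\<lambda>_. 0)) = is_prefix e q" for q
      by (auto simp: fun_eq_iff)
    then have "realizes (=) sierpinski_rep (machine_with_oracle n (\<lambda>_. e))
        (char_fun (=) {q. is_prefix e q})"
      unfolding realizes_def machine_with_oracle_def n sierpinski_rep_def char_fun_def points_def
      by simp
    then show ?thesis
      unfolding open_rep_def fun_rep_def char_fun_def points_def by auto
  qed
  then show ?thesis by blast
qed

text \<open>Machine \<open>m\<close> must be simulated here, as its oracle is itself computed from
  \<open>e\<close>. The conditional brings halting into the form searched by
  \<open>comp_fun_Least\<close>, and the final subtraction undoes the successor in
  \<open>run\<close>.\<close>

definition image_name :: "nat \<Rightarrow> nat \<Rightarrow> nat \<Rightarrow> baire" where
  "image_name m n e k =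
    run (\<lambda>x. Suc (indexed n (\<lambda>_. e) x)) m k
      (LEAST t. (if run (\<lambda>x. Suc (indexed n (\<lambda>_. e) x)) m k t = 0 then 1 else 0) = (0::nat)) - 1"

lemma run_halts:
  assumes "eval (code_of m) r k v" shows "\<exists>t. run (\<lambda>x. Suc (r x)) m k t \<noteq> 0"
proof -
  obtain c where "certifies (\<lambda>x. Suc (r x)) m k c"
    using certifies_complete[OF assms, of "\<lambda>x. Suc (r x)"] by auto
  then have "run (\<lambda>x. Suc (r x)) m k (Suc c) \<noteq> 0" by (auto simp: run_eq_0_iff)
  then show ?thesis by blast
qed

lemma image_name:
  assumes "machine m (indexed n (\<lambda>_. e)) = Some R"
  shows "image_name m n e = R"
proof
  fix k
  let ?r = "indexed n (\<lambda>_. e)"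
  let ?t = "LEAST t. (if run (\<lambda>x. Suc (?r x)) m k t = 0 then 1 else 0) = (0::nat)"
  have ev: "eval (code_of m) ?r k (R k)" by (rule machine_eq_SomeD[OF assms])
  have "\<exists>t. (if run (\<lambda>x. Suc (?r x)) m k t = 0 then 1 else 0) = (0::nat)"
    using run_halts[OF ev] by auto
  from LeastI_ex[OF this] obtain v where v: "run (\<lambda>x. Suc (?r x)) m k ?t = Suc v"
    by (cases "run (\<lambda>x. Suc (?r x)) m k ?t") simp_all
  have "eval (code_of m) ?r k v" using v by (rule run_sound) simp
  then have "v = R k" using ev by (rule eval_deterministic)
  then show "image_name m n e k = R k" unfolding image_name_def v by simp
qed

lemma comp_fun_image_name:
  assumes "\<And>e. machine m (indexed n (\<lambda>_. e)) = Some (R e)" and "comp_fun f" "comp_fun g"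
  shows "comp_fun (\<lambda>s z. image_name m n (f s z) (g s z))"
proof -
  have ex: "\<exists>t. (if run (\<lambda>x. Suc (indexed n (\<lambda>_. e) x)) m k t = 0 then 1 else 0) = (0::nat)" for e k
    using run_halts[OF machine_eq_SomeD[OF assms(1)[of e], of k]] by auto
  have ix: "comp_fun (\<lambda>r z. indexed n (\<lambda>_. f r z) (g r z))" if "comp_fun f" "comp_fun g" for f g
    unfolding indexed_def by (intro comp_fun_intros that)
  have "comp_fun (\<lambda>s z. image_name m n (pi1 z) (pi2 z))"
    unfolding image_name_def
    by (intro comp_fun_minus comp_fun_run comp_fun_Least ex ix comp_fun_intros)
  from comp_fun_compose[OF this comp_fun_pair[OF assms(2,3)]] show ?thesis by simp
qed

section \<open>One realizer for all names, obtained from the transform\<close>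

theorem theorem57:
  fixes X :: "'a set" and \<delta> :: "'a rep"
  assumes "quasi_polish X \<delta>"
  shows "(\<forall>A\<subseteq>X. char_fun \<delta> A \<in> points (fun_rep \<delta> SB_rep) \<longrightarrow> A \<in> points (borel_rep \<delta>)) \<and>
    computable_map (fun_rep \<delta> SB_rep) (borel_rep \<delta>) (set_of_char \<delta>)"
proof -
  obtain dl where X: "represented_space X \<delta>" and T0: "T0_rep \<delta>"
    and eqv: "equivalent_rep \<delta> (\<lambda>p x. x = dl p)" and eo: "effectively_open \<delta> dl"
    using assms unfolding quasi_polish_def by blast
  have "computable_map (\<lambda>p x. x = dl p) \<delta> id" using eqv by (simp add: equivalent_rep_def)
  then obtain nE where "realizes (\<lambda>p x. x = dl p) \<delta> (machine nE) id"
    unfolding computable_map_def computable_def by blast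
  then have "\<exists>r. machine nE q = Some r \<and> \<delta> r (dl q)" for q
    unfolding realizes_def by simp
  then obtain E where nE: "\<And>q. machine nE q = Some (E q)" "\<And>q. \<delta> (E q) (dl q)" by metis
  have points: "points \<delta> = range dl"
  proof
    show "range dl \<subseteq> points \<delta>" using nE(2) by (auto simp: points_def)
    have "computable_map \<delta> (\<lambda>p x. x = dl p) id" using eqv by (simp add: equivalent_rep_def)
    then show "points \<delta> \<subseteq> range dl"
      unfolding computable_map_def realizes_def points_def by fastforce
  qed
  obtain n0 where n0: "\<And>e. open_rep (=) (indexed n0 (\<lambda>_. e)) {q. is_prefix e q}"
    using cylinder_names by blast
  obtain m0 where "realizes (open_rep (=)) (open_rep \<delta>) (machine m0) (\<lambda>U. dl ` U)"
    using eo unfolding effectively_open_def computable_map_def computable_def by blast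
  then have "\<exists>r. machine m0 (indexed n0 (\<lambda>_. e)) = Some r \<and> open_rep \<delta> r (dl ` {q. is_prefix e q})" for e
    using n0[of e] unfolding realizes_def by blast
  then obtain R where R: "\<And>e. machine m0 (indexed n0 (\<lambda>_. e)) = Some (R e)"
    "\<And>e. open_rep \<delta> (R e) (dl ` {q. is_prefix e q})" by metis
  \<comment> \<open>The numbers \<open>nE\<close>, \<open>n0\<close> and \<open>m0\<close> depend
    only on the space, and \<open>s\<close> enters as oracle, so one machine realizes the map;
    \<open>n\<close> and \<open>p\<close> are unpacked only to verify it.\<close>
  define \<Phi> where "\<Phi> s = bcode (label nE s) (image_name m0 n0) (state (Suc 0) 0 0)" for s
  have "comp_fun (\<lambda>s k. \<Phi> s k)"
    unfolding \<Phi>_def by (intro comp_fun_bcode comp_fun_label comp_fun_image_name[OF R(1)])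
  then obtain N where N: "\<And>s. machine N s = Some (\<Phi> s)" using comp_fun_machine by blast
  have \<Phi>: "borel_rep \<delta> (\<Phi> s) (set_of_char \<delta> f)" if name: "fun_rep \<delta> SB_rep s f" for s f
  proof -
    obtain n p where s: "s = indexed n p" and rl: "realizes \<delta> SB_rep (machine_with_oracle n p) f"
      using name unfolding fun_rep_def by blast
    have "\<exists>r. machine n (join p (E q)) = Some r \<and> SB_rep r (f (dl q))" for q
      using rl nE(2)[of q] unfolding realizes_def machine_with_oracle_def by blast
    then obtain G where G_name: "\<And>q. machine n (join p (E q)) = Some (G q)"
      "\<And>q. SB_rep (G q) (f (dl q))" by metis
    interpret approximation_data nE n p E G
      by unfold_locales (rule nE(1), rule G_name(1))
    interpret vaught_transform \<delta> dl G lab "image_name m0 n0" f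
    proof
      show "open_rep \<delta> (image_name m0 n0 e) (dl ` {q. is_prefix e q})" for e
        using R(2) unfolding image_name[OF R(1)] .
      show "\<exists>m. \<forall>q'. (\<forall>i<m. q' i = q i) \<longrightarrow> dl q' \<in> U"
        if "U \<in> points (open_rep \<delta>)" "dl q \<in> U" for U q
        using nE that by (rule open_continuous)
      show "BC_value (G q) (f (dl q))" for q using G_name(2) by (simp add: SB_rep_def)
    qed (fact points T0 label_sound label_limit label_mono)+
    show ?thesis using borel_code unfolding \<Phi>_def s set_of_char_def .
  qed
  have comp: "computable_map (fun_rep \<delta> SB_rep) (borel_rep \<delta>) (set_of_char \<delta>)"
    unfolding computable_map_def computable_def realizes_def using N \<Phi> by blast
  \<comment> \<open>A Borel name of \<open>A\<close> is obtained by applying the realizer to any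
    name of its characteristic function.\<close>
  have "A \<in> points (borel_rep \<delta>)" if A: "A \<subseteq> X" "char_fun \<delta> A \<in> points (fun_rep \<delta> SB_rep)" for A
  proof -
    obtain s where "fun_rep \<delta> SB_rep s (char_fun \<delta> A)" using A(2) unfolding points_def by blast
    then have "borel_rep \<delta> (\<Phi> s) (set_of_char \<delta> (char_fun \<delta> A))" by (rule \<Phi>)
    moreover have "set_of_char \<delta> (char_fun \<delta> A) = A"
      using A(1) X by (intro set_of_char_char_fun) (simp add: represented_space_def)
    ultimately show ?thesis by (auto simp: points_def)
  qed
  then show ?thesis using comp by blast
qed

end
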